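(* On $E_7:\ v^2=u(1-11u+32u^2)$ let $\Phi_7=\dfrac{128(1-4u)(-v-3u+4uv+20u^2)^7}{u^3(1-8u)(1-4v-20u+64u^2)^7}$ and $F_3=1-4v-4u$, $\widetilde F_3=1+4v-4u$, $\widetilde F_4=1+2v-6u$, $G_3=1+2v-10u+16u^2$, $G_4=1-4v-20u+64u^2$, $\widehat G_4=v-5u-8uv+24u^2$. Then near $(u,v)=(0,0)$ on $E_7$, with branches chosen so that each right-hand side is holomorphic at $(0,0)$ with value $1$: $${}_3F_2\!\left(-\tfrac1{14},\tfrac3{14},\tfrac{11}{14};\tfrac47,\tfrac67;\Phi_7\right)=\frac{(1-4u)^{1/7}\widetilde F_3^{3/14}\widetilde F_4^{1/7}}{(1-8u)^{1/14}\sqrt{G_4}},$$ $${}_3F_2\!\left(\tfrac1{14},\tfrac5{14},\tfrac{13}{14};\tfrac57,\tfrac87;\Phi_7\right)=\frac{(1-4u)^{2/7}(1-8u)^{1/7}F_3^{1/14}\widetilde F_4^{2/7}\sqrt{G_4}}{G_3},$$ $${}_3F_2\!\left(\tfrac5{14},\tfrac9{14},\tfrac{17}{14};\tfrac97,\tfrac{10}7;\Phi_7\right)=\frac{(1-8u)(v-u)^{3/14}\widehat G_4^{5/2}}{u^{8/7}(v+u)^{3/7}\widetilde F_3^{1/14}G_3^3}.$$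
   Context: ${}_3F_2(\alpha_1,\alpha_2,\alpha_3;\beta_1,\beta_2;z)=\sum_{n\ge0}\frac{(\alpha_1)_n(\alpha_2)_n(\alpha_3)_n}{(\beta_1)_n(\beta_2)_n n!}z^n$. A local parameter of $E_7$ at $(0,0)$ is $\sqrt u$. *)

theory Defs
  imports "HOL-Complex_Analysis.Complex_Analysis"
begin

definition hyp3F2 :: "complex \<Rightarrow> complex \<Rightarrow> complex \<Rightarrow> complex \<Rightarrow> complex \<Rightarrow> complex \<Rightarrow> complex" where
  "hyp3F2 a1 a2 a3 b1 b2 z =
     (\<Sum>n. pochhammer a1 n * pochhammer a2 n * pochhammer a3 n
            / (pochhammer b1 n * pochhammer b2 n * fact n) * z ^ n)"

text \<open>Local parametrization of E7: v^2 = u(1-11u+32u^2) near (0,0) by the local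
  parameter t = sqrt u, i.e. u = t^2, v = t * sqrt(1-11t^2+32t^4) (branch with value 1 at t=0).\<close>
definition E7u :: "complex \<Rightarrow> complex" where
  "E7u t = t ^ 2"

definition E7v :: "complex \<Rightarrow> complex" where
  "E7v t = t * csqrt (1 - 11 * t ^ 2 + 32 * t ^ 4)"

definition Phi7 :: "complex \<Rightarrow> complex \<Rightarrow> complex" where
  "Phi7 u v = 128 * (1 - 4*u) * (- v - 3 * u + 4 * u * v + 20 * u ^ 2) ^ 7
              / (u ^ 3 * (1 - 8*u) * (1 - 4 * v - 20 * u + 64 * u ^ 2) ^ 7)"

definition F3 :: "complex \<Rightarrow> complex \<Rightarrow> complex" where "F3 u v = 1 - 4* v - 4*u"
definition F3t :: "complex \<Rightarrow> complex \<Rightarrow> complex" where "F3t u v = 1 + 4* v - 4*u"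
definition F4t :: "complex \<Rightarrow> complex \<Rightarrow> complex" where "F4t u v = 1 + 2* v - 6*u"
definition G3 :: "complex \<Rightarrow> complex \<Rightarrow> complex" where "G3 u v = 1 + 2* v - 10*u + 16*u^2"
definition G4 :: "complex \<Rightarrow> complex \<Rightarrow> complex" where "G4 u v = 1 - 4* v - 20*u + 64*u^2"
definition G4h :: "complex \<Rightarrow> complex \<Rightarrow> complex" where "G4h u v = v - 5*u - 8*u* v + 24*u^2"

end

theory Submission
  imports Defs
begin

text \<open>
  Each right-hand side \<open>R\<close> is a root of a function on the elliptic curve whose divisor is supported above the branch
  points \<open>z = 0\<close> and \<open>z = \<infinity>\<close> of \<open>z = Phi7\<close>. So the derivatives \<open>\<theta>\<^sup>j R\<close> for \<open>\<theta> = z d/dz\<close> are \<open>R\<close> times explicit rational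
  functions on the curve, and the hypergeometric differential equation for \<open>R\<close> becomes a polynomial identity modulo
  the equation of the curve. As \<open>Phi7\<close> has a simple zero at the base point, \<open>R\<close> is a holomorphic function of \<open>z\<close>
  near \<open>0\<close>. The equation determines its Taylor coefficients from \<open>R = 1\<close> at \<open>z = 0\<close>, because the other local exponents
  \<open>1 - b\<^sub>1\<close> and \<open>1 - b\<^sub>2\<close> are not positive integers.
\<close>

section \<open>Pullbacks of the hypergeometric equation\<close>

text \<open>The formulas exist because the covering fits the equations. \<open>Phi7\<close> has
  degree 24 on the curve, with ramification indices 7, 7, 7, 1, 1, 1 above 0 and above infinity, and
  only even indices above 1. In all three cases the local exponents at 0 and at infinity differ by
  multiples of 1/7, and those at 1 are 0, 1 and 1/2, since \<open>b1 + b2 - (a1 + a2 + a3)\<close>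
  is 1/2. The pulled-back equation thus has integral exponent differences except at the six
  unramified points above 0 and infinity. The obstacle is the fractional powers. All their exponents
  are multiples of 1/14, so each formula is replaced by \<open>R ^ 14 = h\<close> with
  \<open>h\<close> rational on the curve and \<open>h\<close> equal to 1 at the base point. Only the
  logarithmic derivative of \<open>h\<close> enters the differential equation, and there no root is
  left except that of the parametrization.\<close>

lemma hyp3F2_eq_if_fps_ode:
  fixes F :: "complex fps" and a1 a2 a3 b1 b2 :: complex
  defines "\<theta> \<equiv> (\<lambda>G :: complex fps. fps_X * fps_deriv G)"
  assumes f: "f has_fps_expansion F" and F0: "fps_nth F 0 = 1"
    and b1: "\<And>n. b1 + of_nat n \<noteq> 0" and b2: "\<And>n. b2 + of_nat n \<noteq> 0"
    and ode: "\<theta> (\<theta> (\<theta> F)) + fps_const (b1 + b2 - 2) * \<theta> (\<theta> F) + fps_const ((b1 - 1) * (b2 - 1)) * \<theta> F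
      = fps_X * (\<theta> (\<theta> (\<theta> F)) + fps_const (a1 + a2 + a3) * \<theta> (\<theta> F)
          + fps_const (a1 * a2 + a1 * a3 + a2 * a3) * \<theta> F + fps_const (a1 * a2 * a3) * F)"
  shows "\<forall>\<^sub>F z in nhds 0. hyp3F2 a1 a2 a3 b1 b2 z = f z"
proof -
  have \<theta>_nth: "fps_nth (\<theta> G) n = of_nat n * fps_nth G n" for G n
    by (cases n) (simp_all add: \<theta>_def)
  \<comment> \<open>At index \<open>Suc n\<close> the operators \<open>\<theta>\<close>,
    \<open>\<theta> + b1 - 1\<close> and \<open>\<theta> + b2 - 1\<close> act as
    \<open>n + 1\<close>, \<open>b1 + n\<close> and \<open>b2 + n\<close>, while
    \<open>fps_X\<close> shifts the right-hand side to index \<open>n\<close>.\<close>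
  have rec: "(of_nat n + 1) * (b1 + of_nat n) * (b2 + of_nat n) * fps_nth F (Suc n)
      = (a1 + of_nat n) * (a2 + of_nat n) * (a3 + of_nat n) * fps_nth F n" for n
  proof -
    from ode have "fps_nth (\<theta> (\<theta> (\<theta> F)) + fps_const (b1 + b2 - 2) * \<theta> (\<theta> F) + fps_const ((b1 - 1) * (b2 - 1)) * \<theta> F) (Suc n)
      = fps_nth (fps_X * (\<theta> (\<theta> (\<theta> F)) + fps_const (a1 + a2 + a3) * \<theta> (\<theta> F)
          + fps_const (a1 * a2 + a1 * a3 + a2 * a3) * \<theta> F + fps_const (a1 * a2 * a3) * F)) (Suc n)"
      by simp
    then have "(of_nat (Suc n) ^ 3 + (b1 + b2 - 2) * of_nat (Suc n) ^ 2 + (b1 - 1) * (b2 - 1) * of_nat (Suc n)) * fps_nth F (Suc n)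
      = (of_nat n ^ 3 + (a1 + a2 + a3) * of_nat n ^ 2 + (a1 * a2 + a1 * a3 + a2 * a3) * of_nat n + a1 * a2 * a3) * fps_nth F n"
      by (simp add: \<theta>_nth ring_distribs power2_eq_square power3_eq_cube mult.assoc del: of_nat_Suc fps_const_mult)
    then show ?thesis
      by (simp add: algebra_simps power2_eq_square power3_eq_cube)
  qed
  have F_nth: "fps_nth F n = pochhammer a1 n * pochhammer a2 n * pochhammer a3 n
      / (pochhammer b1 n * pochhammer b2 n * fact n)" for n
  proof (induction n)
    case 0
    then show ?case by (simp add: F0)
  next
    case (Suc n)
    have nz: "(of_nat n + 1 :: complex) \<noteq> 0"
      by (metis of_nat_Suc of_nat_eq_0_iff add.commute nat.distinct(1))
    have "fps_nth F (Suc n) = (a1 + of_nat n) * (a2 + of_nat n) * (a3 + of_nat n)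
        / ((of_nat n + 1) * (b1 + of_nat n) * (b2 + of_nat n)) * fps_nth F n"
      using rec[of n] b1[of n] b2[of n] nz by (simp add: eq_divide_eq mult_ac)
    also have "\<dots> = pochhammer a1 (Suc n) * pochhammer a2 (Suc n) * pochhammer a3 (Suc n)
        / (pochhammer b1 (Suc n) * pochhammer b2 (Suc n) * fact (Suc n))"
      unfolding Suc.IH pochhammer_Suc fact_Suc by (simp add: mult_ac add_ac)
    finally show ?case .
  qed
  \<comment> \<open>Convergence of the hypergeometric series is inherited from the expansion of
    \<open>f\<close>.\<close>
  have "\<forall>\<^sub>F z in nhds 0. eval_fps F z = f z"
    using f by (simp add: has_fps_expansion_def)
  then show ?thesis
    by eventually_elim (simp add: hyp3F2_def eval_fps_def F_nth)
qed

text \<open>Logarithmic derivatives are available only off the base point, where several factors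
  vanish; continuity carries the resulting identities over to it.\<close>

lemma eventually_nhds_eq_if_at:
  fixes f g :: "complex \<Rightarrow> complex"
  assumes "\<forall>\<^sub>F t in at a. f t = g t" and f: "f analytic_on {a}" and g: "g analytic_on {a}"
  shows "\<forall>\<^sub>F t in nhds a. f t = g t"
proof -
  have "f \<midarrow>a\<rightarrow> f a" "g \<midarrow>a\<rightarrow> g a"
    using f g analytic_at_imp_isCont isContD by blast+
  then have "f \<midarrow>a\<rightarrow> g a"
    using assms(1) by (simp add: tendsto_cong)
  with \<open>f \<midarrow>a\<rightarrow> f a\<close> have "f a = g a"
    by (metis LIM_unique)
  with assms(1) show ?thesis
    by (simp add: eventually_nhds_conv_at)
qed

lemma eventually_analytic_at:
  assumes "f analytic_on {a}"
  shows "\<forall>\<^sub>F t in nhds a. f analytic_on {t}"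
  using assms unfolding eventually_nhds by (metis analytic_at)

text \<open>\<open>R1\<close>, \<open>R2\<close>, \<open>R3\<close> play the role of
  \<open>\<theta>\<close>-derivatives of \<open>R0\<close> with respect to
  \<open>z = \<phi> t\<close>: the relations \<open>R1\<close> to \<open>R3\<close> say
  \<open>\<theta> = (\<phi> / \<phi>') d/dt\<close> without dividing by anything that may vanish. A
  local inverse of \<open>\<phi>\<close> moves everything to the \<open>z\<close>-plane.\<close>

lemma hyp3F2_eq_if_pullback_ode:
  fixes \<phi> R0 R1 R2 R3 :: "complex \<Rightarrow> complex"
  assumes an: "\<phi> analytic_on {0}" "R0 analytic_on {0}" "R1 analytic_on {0}" "R2 analytic_on {0}"
      "R3 analytic_on {0}"
    and \<phi>0: "\<phi> 0 = 0" and d\<phi>0: "deriv \<phi> 0 \<noteq> 0" and R00: "R0 0 = 1"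
    and R1: "\<forall>\<^sub>F t in at 0. \<phi> t * deriv R0 t = deriv \<phi> t * R1 t"
    and R2: "\<forall>\<^sub>F t in at 0. \<phi> t * deriv R1 t = deriv \<phi> t * R2 t"
    and R3: "\<forall>\<^sub>F t in at 0. \<phi> t * deriv R2 t = deriv \<phi> t * R3 t"
    and ode: "\<forall>\<^sub>F t in at 0. R3 t + (b1 + b2 - 2) * R2 t + (b1 - 1) * (b2 - 1) * R1 t
      = \<phi> t * (R3 t + (a1 + a2 + a3) * R2 t + (a1 * a2 + a1 * a3 + a2 * a3) * R1 t + a1 * a2 * a3 * R0 t)"
    and b1: "\<And>n. b1 + of_nat n \<noteq> 0" and b2: "\<And>n. b2 + of_nat n \<noteq> 0"
  shows "\<forall>\<^sub>F t in nhds 0. hyp3F2 a1 a2 a3 b1 b2 (\<phi> t) = R0 t"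
proof -
  have "\<forall>\<^sub>F t in nhds 0. \<phi> t * deriv R0 t = deriv \<phi> t * R1 t \<and> \<phi> t * deriv R1 t = deriv \<phi> t * R2 t
      \<and> \<phi> t * deriv R2 t = deriv \<phi> t * R3 t
      \<and> R3 t + (b1 + b2 - 2) * R2 t + (b1 - 1) * (b2 - 1) * R1 t
      = \<phi> t * (R3 t + (a1 + a2 + a3) * R2 t + (a1 * a2 + a1 * a3 + a2 * a3) * R1 t + a1 * a2 * a3 * R0 t)"
    by (intro eventually_conj eventually_nhds_eq_if_at R1 R2 R3 ode analytic_intros an) 
  moreover have "\<forall>\<^sub>F t in nhds 0. \<phi> analytic_on {t} \<and> R0 analytic_on {t} \<and> R1 analytic_on {t}
      \<and> R2 analytic_on {t} \<and> R3 analytic_on {t}"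
    using an by (intro eventually_conj eventually_analytic_at)
  ultimately have "\<forall>\<^sub>F t in nhds 0. (\<phi> t * deriv R0 t = deriv \<phi> t * R1 t \<and> \<phi> t * deriv R1 t = deriv \<phi> t * R2 t
      \<and> \<phi> t * deriv R2 t = deriv \<phi> t * R3 t
      \<and> R3 t + (b1 + b2 - 2) * R2 t + (b1 - 1) * (b2 - 1) * R1 t
      = \<phi> t * (R3 t + (a1 + a2 + a3) * R2 t + (a1 * a2 + a1 * a3 + a2 * a3) * R1 t + a1 * a2 * a3 * R0 t))
      \<and> (\<phi> analytic_on {t} \<and> R0 analytic_on {t} \<and> R1 analytic_on {t}
      \<and> R2 analytic_on {t} \<and> R3 analytic_on {t})"
    by (rule eventually_conj)
  then obtain U where U: "open U" "0 \<in> U" and U_an: "\<And>t. t \<in> U \<Longrightarrow> \<phi> analytic_on {t} \<and> R0 analytic_on {t}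
      \<and> R1 analytic_on {t} \<and> R2 analytic_on {t} \<and> R3 analytic_on {t}"
    and U_eq: "\<And>t. t \<in> U \<Longrightarrow> \<phi> t * deriv R0 t = deriv \<phi> t * R1 t \<and> \<phi> t * deriv R1 t = deriv \<phi> t * R2 t
      \<and> \<phi> t * deriv R2 t = deriv \<phi> t * R3 t
      \<and> R3 t + (b1 + b2 - 2) * R2 t + (b1 - 1) * (b2 - 1) * R1 t
      = \<phi> t * (R3 t + (a1 + a2 + a3) * R2 t + (a1 * a2 + a1 * a3 + a2 * a3) * R1 t + a1 * a2 * a3 * R0 t)"
    unfolding eventually_nhds by blast
  have hol: "\<phi> holomorphic_on U" "R0 holomorphic_on U" "R1 holomorphic_on U" "R2 holomorphic_on U"
      "R3 holomorphic_on U"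
    using U_an by (meson analytic_imp_holomorphic analytic_on_analytic_at)+
  obtain r where r: "r > 0" "ball 0 r \<subseteq> U" and inj: "inj_on \<phi> (ball 0 r)"
    using has_complex_derivative_locally_injective[OF hol(1) U(2,1) d\<phi>0] by blast
  have hol_r: "\<phi> holomorphic_on ball 0 r"
    using hol(1) r(2) holomorphic_on_subset by blast
  obtain g where g_hol: "g holomorphic_on \<phi> ` ball 0 r"
    and dg: "\<And>t. t \<in> ball 0 r \<Longrightarrow> deriv \<phi> t * deriv g (\<phi> t) = 1"
    and g_inv: "\<And>t. t \<in> ball 0 r \<Longrightarrow> g (\<phi> t) = t"
    using holomorphic_has_inverse[OF hol_r open_ball inj] by metis
  define V where "V = \<phi> ` ball 0 r"
  have V: "open V" "0 \<in> V"
    using open_mapping_thm3[OF hol_r open_ball inj] r(1) \<phi>0 by (auto simp: V_def intro!: image_eqI[of _ _ 0])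
  have gV: "g ` V \<subseteq> U"
    using g_inv r(2) by (auto simp: V_def)
  define E where "E R = fps_expansion (R \<circ> g) 0" for R
  have comp_hol: "R \<circ> g holomorphic_on V" if "R holomorphic_on U" for R
    using that g_hol gV unfolding V_def by (metis holomorphic_on_compose_gen)
  have E: "(R \<circ> g) has_fps_expansion E R" if "R holomorphic_on U" for R
    unfolding E_def using comp_hol[OF that] V by blast
  \<comment> \<open>Chain rule for \<open>R \<circ> g\<close>, with \<open>g'\<close> eliminated by
    \<open>dg\<close>.\<close>
  have step: "E R' = fps_X * fps_deriv (E R)"
    if R: "R holomorphic_on U" "R' holomorphic_on U" "\<And>t. t \<in> U \<Longrightarrow> \<phi> t * deriv R t = deriv \<phi> t * R' t"
    for R R'
  proof -
    have "z * deriv (R \<circ> g) z = (R' \<circ> g) z" if z: "z \<in> V" for z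
    proof -
      obtain t where t: "t \<in> ball 0 r" "z = \<phi> t"
        using z by (auto simp: V_def)
      have "deriv (R \<circ> g) z = deriv R (g z) * deriv g z"
      proof (rule deriv_chain)
        show "g field_differentiable at z"
          using g_hol V(1) z by (simp add: V_def holomorphic_on_imp_differentiable_at)
        show "R field_differentiable at (g z)"
          using R(1) U(1) gV z by (blast intro: holomorphic_on_imp_differentiable_at)
      qed
      moreover have "\<phi> t * deriv R t = deriv \<phi> t * R' t"
        using R(3) t(1) r(2) by blast
      ultimately have "z * deriv (R \<circ> g) z = deriv \<phi> t * deriv g (\<phi> t) * R' t"
        by (simp add: g_inv[OF t(1)] t(2))
      then show ?thesis
        by (simp add: dg[OF t(1)] g_inv[OF t(1)] t(2))
    qed
    then have "\<forall>\<^sub>F z in nhds 0. z * deriv (R \<circ> g) z = (R' \<circ> g) z"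
      using V by (metis (mono_tags, lifting) eventually_nhds)
    moreover have "(\<lambda>z. z * deriv (R \<circ> g) z) has_fps_expansion fps_X * fps_deriv (E R)"
      using E[OF R(1)] by (intro fps_expansion_intros)
    ultimately have "(R' \<circ> g) has_fps_expansion fps_X * fps_deriv (E R)"
      by (subst has_fps_expansion_cong[OF _ refl, symmetric])
    with E[OF R(2)] show ?thesis
      using fps_expansion_unique_complex by blast
  qed
  define \<theta> where "\<theta> = (\<lambda>G :: complex fps. fps_X * fps_deriv G)"
  have E1: "E R1 = \<theta> (E R0)" and E2: "E R2 = \<theta> (\<theta> (E R0))" and E3: "E R3 = \<theta> (\<theta> (\<theta> (E R0)))"
    using step hol U_eq by (simp_all add: \<theta>_def)
  define l where "l = (\<lambda>z. (R3 \<circ> g) z + (b1 + b2 - 2) * (R2 \<circ> g) z + (b1 - 1) * (b2 - 1) * (R1 \<circ> g) z)"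
  define rr where "rr = (\<lambda>z. z * ((R3 \<circ> g) z + (a1 + a2 + a3) * (R2 \<circ> g) z
      + (a1 * a2 + a1 * a3 + a2 * a3) * (R1 \<circ> g) z + a1 * a2 * a3 * (R0 \<circ> g) z))"
  have "l z = rr z" if "z \<in> V" for z
    using that g_inv U_eq r(2) by (force simp: V_def l_def rr_def)
  then have ev: "\<forall>\<^sub>F z in nhds 0. l z = rr z"
    using V by (metis (mono_tags, lifting) eventually_nhds)
  have lE: "l has_fps_expansion E R3 + fps_const (b1 + b2 - 2) * E R2 + fps_const ((b1 - 1) * (b2 - 1)) * E R1"
    unfolding l_def by (intro fps_expansion_intros E hol)
  have "rr has_fps_expansion fps_X * (E R3 + fps_const (a1 + a2 + a3) * E R2
      + fps_const (a1 * a2 + a1 * a3 + a2 * a3) * E R1 + fps_const (a1 * a2 * a3) * E R0)"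
    unfolding rr_def by (intro fps_expansion_intros E hol)
  then have "l has_fps_expansion fps_X * (E R3 + fps_const (a1 + a2 + a3) * E R2
      + fps_const (a1 * a2 + a1 * a3 + a2 * a3) * E R1 + fps_const (a1 * a2 * a3) * E R0)"
    by (subst has_fps_expansion_cong[OF ev refl])
  note ode' = fps_expansion_unique_complex[OF lE this]
  have g0: "g 0 = 0"
    using g_inv[of 0] r(1) \<phi>0 by simp
  have "fps_nth (E R0) 0 = 1"
    using has_fps_expansion_imp_0_eq_fps_nth_0[OF E[OF hol(2)]] R00 g0 by simp
  then have "\<forall>\<^sub>F z in nhds 0. hyp3F2 a1 a2 a3 b1 b2 z = (R0 \<circ> g) z"
    using hyp3F2_eq_if_fps_ode[OF E[OF hol(2)] _ b1 b2, of a1 a2 a3] ode'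
    by (simp add: E1 E2 E3 \<theta>_def)
  moreover have "filterlim \<phi> (nhds 0) (nhds 0)"
    using analytic_at_imp_isCont[OF an(1)] \<phi>0 by (simp add: isCont_def tendsto_nhds_iff)
  ultimately have "\<forall>\<^sub>F t in nhds 0. hyp3F2 a1 a2 a3 b1 b2 (\<phi> t) = (R0 \<circ> g) (\<phi> t)"
    by (rule eventually_compose_filterlim)
  moreover have "\<forall>\<^sub>F t in nhds 0. t \<in> ball 0 r"
    using r(1) by (intro eventually_nhds_in_open) auto
  ultimately show ?thesis
    by eventually_elim (simp add: g_inv)
qed


section \<open>Logarithmic derivatives\<close>

text \<open>With nonvanishing built in, \<open>L\<close> is determined by \<open>f\<close>, and
  products, quotients and roots act on \<open>L\<close> linearly.\<close>

definition has_logderiv :: "(complex \<Rightarrow> complex) \<Rightarrow> complex \<Rightarrow> complex \<Rightarrow> bool" where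
  "has_logderiv f L t \<longleftrightarrow> f t \<noteq> 0 \<and> (f has_field_derivative L * f t) (at t)"

lemma has_logderiv_const: "c \<noteq> 0 \<Longrightarrow> has_logderiv (\<lambda>_. c) 0 t"
  by (simp add: has_logderiv_def)

lemma has_logderiv_mult:
  assumes "has_logderiv f L t" "has_logderiv g M t"
  shows "has_logderiv (\<lambda>t. f t * g t) (L + M) t"
  using assms unfolding has_logderiv_def
  by (auto intro!: derivative_eq_intros simp: algebra_simps)

lemma has_logderiv_divide:
  assumes "has_logderiv f L t" "has_logderiv g M t"
  shows "has_logderiv (\<lambda>t. f t / g t) (L - M) t"
  using assms unfolding has_logderiv_def
  by (auto intro!: derivative_eq_intros simp: field_simps)

lemma has_logderiv_power:
  assumes "has_logderiv f L t"
  shows "has_logderiv (\<lambda>t. f t ^ n) (of_nat n * L) t"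
proof (cases n)
  case (Suc m)
  have "((\<lambda>t. f t ^ Suc m) has_field_derivative (1 + of_nat m) * (L * f t * f t ^ m)) (at t)"
    using assms unfolding has_logderiv_def by (intro DERIV_power_Suc) simp
  with assms Suc show ?thesis
    by (simp add: has_logderiv_def algebra_simps)
qed (simp add: has_logderiv_def)

lemmas has_logderiv_intros = has_logderiv_const has_logderiv_mult has_logderiv_divide has_logderiv_power

lemma has_logderiv_cong_ev:
  assumes "\<forall>\<^sub>F x in nhds t. f x = g x" "has_logderiv f L t"
  shows "has_logderiv g L t"
  using assms DERIV_cong_ev[OF refl assms(1) refl] eventually_nhds_x_imp_x[OF assms(1)]
  by (simp add: has_logderiv_def)

lemma has_logderiv_root:
  assumes "has_logderiv h L t" "h t \<notin> \<real>\<^sub>\<le>\<^sub>0" "c \<noteq> 0"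
  shows "has_logderiv (\<lambda>t. exp (Ln (h t) / c)) (L / c) t"
  using assms unfolding has_logderiv_def
  by (auto intro!: derivative_eq_intros simp: field_simps)

section \<open>Functions on the curve\<close>

type_synonym ell = "complex poly \<times> complex poly"

text \<open>The unit cofactor of \<open>E7v t = t * E7s t\<close>; keeping it apart makes the powers
  of \<open>t\<close> in zeros at the base point visible.\<close>

definition E7s :: "complex \<Rightarrow> complex" where
  "E7s t = csqrt (1 - 11 * t ^ 2 + 32 * t ^ 4)"

text \<open>The pair \<open>(A, B)\<close> stands for the function \<open>A(X) + B(X) Y\<close> on the curve, where \<open>X = 4u\<close> and \<open>Y = 4v\<close>
  satisfy \<open>Y\<^sup>2 = 4X - 11X\<^sup>2 + 8X\<^sup>3\<close>; this rescaling keeps the coefficients below small.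
  The derivation is the invariant one, \<open>X \<mapsto> Y\<close>, \<open>Y \<mapsto> 2 - 11X + 12X\<^sup>2\<close>.\<close>

definition ell_eval :: "ell \<Rightarrow> complex \<Rightarrow> complex" where
  "ell_eval p t = poly (fst p) (4 * t ^ 2) + 4 * (t * E7s t) * poly (snd p) (4 * t ^ 2)"

text \<open>The square of \<open>Y\<close> is reduced at once, so identities modulo the equation of
  the curve become equalities of pairs of polynomials, decided by coefficient arithmetic.\<close>

definition ell_mul :: "ell \<Rightarrow> ell \<Rightarrow> ell" where
  "ell_mul p q = (fst p * fst q + [:0, 4, -11, 8:] * (snd p * snd q), fst p * snd q + snd p * fst q)"

definition ell_scale :: "complex \<Rightarrow> ell \<Rightarrow> ell" where
  "ell_scale c p = (smult c (fst p), smult c (snd p))"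

definition ell_deriv :: "ell \<Rightarrow> ell" where
  "ell_deriv p = ([:0, 4, -11, 8:] * pderiv (snd p) + [:2, -11, 12:] * snd p, pderiv (fst p))"

lemma E7s_squared: "E7s t ^ 2 = 1 - 11 * t ^ 2 + 32 * t ^ 4"
  by (simp add: E7s_def)

lemma ell_eval_add: "ell_eval (p + q) t = ell_eval p t + ell_eval q t"
  by (simp add: ell_eval_def algebra_simps)

lemma ell_eval_diff: "ell_eval (p - q) t = ell_eval p t - ell_eval q t"
  by (simp add: ell_eval_def algebra_simps)

lemma ell_eval_scale: "ell_eval (ell_scale c p) t = c * ell_eval p t"
  by (simp add: ell_eval_def ell_scale_def algebra_simps)

lemma poly_curve: "poly [:0, 4, -11, 8:] (4 * t ^ 2) = (4 * (t * E7s t)) ^ 2"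
proof -
  have "(4 * (t * E7s t)) ^ 2 = 16 * t ^ 2 * E7s t ^ 2"
    by (simp add: power_mult_distrib)
  then show ?thesis
    unfolding E7s_squared by (simp add: algebra_simps power_numeral_even power_numeral_odd)
qed

lemma ell_eval_mul: "ell_eval (ell_mul p q) t = ell_eval p t * ell_eval q t"
proof -
  have "ell_eval (ell_mul p q) t = poly (fst p) (4 * t ^ 2) * poly (fst q) (4 * t ^ 2)
      + (4 * (t * E7s t)) ^ 2 * (poly (snd p) (4 * t ^ 2) * poly (snd q) (4 * t ^ 2))
      + 4 * (t * E7s t) * (poly (fst p) (4 * t ^ 2) * poly (snd q) (4 * t ^ 2)
        + poly (snd p) (4 * t ^ 2) * poly (fst q) (4 * t ^ 2))"
    unfolding ell_eval_def ell_mul_def fst_conv snd_conv poly_add poly_mult poly_curve ..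
  also have "\<dots> = ell_eval p t * ell_eval q t"
    unfolding ell_eval_def by (simp add: algebra_simps power2_eq_square)
  finally show ?thesis .
qed

lemmas ell_eval_simps = ell_eval_add ell_eval_diff ell_eval_scale ell_eval_mul

text \<open>The factor \<open>2 / E7s t\<close> compares \<open>d/dt\<close> with the invariant
  derivation: \<open>dX/dt = 8 * t\<close> is \<open>2 / E7s t\<close> times
  \<open>Y = 4 * t * E7s t\<close>.\<close>

lemma has_field_derivative_ell_eval:
  assumes "1 - 11 * t ^ 2 + 32 * t ^ 4 \<notin> \<real>\<^sub>\<le>\<^sub>0"
  shows "(ell_eval p has_field_derivative 2 / E7s t * ell_eval (ell_deriv p) t) (at t)"
proof -
  define A B where "A = poly (fst p) (4 * t ^ 2)" and "B = poly (snd p) (4 * t ^ 2)"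
  define A' B' where "A' = poly (pderiv (fst p)) (4 * t ^ 2)" and "B' = poly (pderiv (snd p)) (4 * t ^ 2)"
  have s0: "E7s t \<noteq> 0"
    using assms by (auto simp: E7s_def)
  have "(E7s has_field_derivative (- 22 * t + 128 * t ^ 3) / (2 * E7s t)) (at t)"
    unfolding E7s_def using assms by (auto intro!: derivative_eq_intros)
  moreover have "(- 22 * t + 128 * t ^ 3) / (2 * E7s t) = (- 11 * t + 64 * t ^ 3) / E7s t"
    using s0 by (simp add: field_simps)
  ultimately have s': "(E7s has_field_derivative (- 11 * t + 64 * t ^ 3) / E7s t) (at t)"
    by simp
  have q: "((\<lambda>t. poly r (4 * t ^ 2)) has_field_derivative poly (pderiv r) (4 * t ^ 2) * (8 * t)) (at t)" for r
    by (rule DERIV_chain2[OF poly_DERIV]) (auto intro!: derivative_eq_intros)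
  have "(ell_eval p has_field_derivative A' * (8 * t) + (4 * (1 * E7s t + (- 11 * t + 64 * t ^ 3) / E7s t * t) * B
      + B' * (8 * t) * (4 * (t * E7s t)))) (at t)"
    unfolding ell_eval_def A'_def B'_def B_def
    by (intro DERIV_add DERIV_mult q DERIV_cmult s' DERIV_ident)
  moreover have "A' * (8 * t) + (4 * (1 * E7s t + (- 11 * t + 64 * t ^ 3) / E7s t * t) * B
      + B' * (8 * t) * (4 * (t * E7s t))) = 2 / E7s t * (4 * (t * E7s t) * A' + (4 * (t * E7s t)) ^ 2 * B'
      + (2 * E7s t ^ 2 + 2 * t * (- 11 * t + 64 * t ^ 3)) * B)"
    using s0 by (simp add: field_simps power2_eq_square)
  moreover have "ell_eval (ell_deriv p) t = 4 * (t * E7s t) * A' + (4 * (t * E7s t)) ^ 2 * B'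
      + (2 * E7s t ^ 2 + 2 * t * (- 11 * t + 64 * t ^ 3)) * B"
  proof -
    have *: "poly [:2, -11, 12:] (4 * t ^ 2) = 2 * E7s t ^ 2 + 2 * t * (- 11 * t + 64 * t ^ 3)"
      unfolding E7s_squared by (simp add: algebra_simps power_numeral_even power_numeral_odd)
    show ?thesis
      unfolding ell_eval_def ell_deriv_def fst_conv snd_conv poly_add poly_mult poly_curve * A'_def B'_def B_def
      by (simp only: add_ac)
  qed
  ultimately show ?thesis by simp
qed

section \<open>Local behaviour at the base point\<close>

lemma csqrt_arg_0: "1 - 11 * 0 ^ 2 + 32 * 0 ^ 4 \<notin> (\<real>\<^sub>\<le>\<^sub>0 :: complex set)"
  by simp

lemma E7s_0: "E7s 0 = 1"
  by (simp add: E7s_def)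

lemma E7s_analytic: "E7s analytic_on {0}"
  unfolding E7s_def by (auto intro!: analytic_intros)

lemma eventually_csqrt_arg: "\<forall>\<^sub>F t :: complex in nhds 0. 1 - 11 * t ^ 2 + 32 * t ^ 4 \<notin> \<real>\<^sub>\<le>\<^sub>0"
proof -
  have "((\<lambda>t :: complex. 1 - 11 * t ^ 2 + 32 * t ^ 4) \<longlongrightarrow> 1 - 11 * 0 ^ 2 + 32 * 0 ^ 4) (nhds 0)"
    by (intro tendsto_intros filterlim_ident)
  then have "\<forall>\<^sub>F t :: complex in nhds 0. 1 - 11 * t ^ 2 + 32 * t ^ 4 \<in> - \<real>\<^sub>\<le>\<^sub>0"
    by (rule topological_tendstoD) (auto simp: open_Compl)
  then show ?thesis by simp
qed

lemma ell_eval_analytic: "ell_eval p analytic_on {0}"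
proof -
  obtain U where "open U" "0 \<in> U" "\<And>t :: complex. t \<in> U \<Longrightarrow> 1 - 11 * t ^ 2 + 32 * t ^ 4 \<notin> \<real>\<^sub>\<le>\<^sub>0"
    using eventually_csqrt_arg unfolding eventually_nhds by blast
  then show ?thesis
    unfolding analytic_at by (metis holomorphic_on_open has_field_derivative_ell_eval)
qed

text \<open>The invariant derivation does not vanish at the base point, so \<open>ell_deriv\<close>
  detects simple zeros there, and such zeros are isolated.\<close>

lemma eventually_ell_eval_nonzero:
  assumes "ell_eval p 0 \<noteq> 0 \<or> ell_eval (ell_deriv p) 0 \<noteq> 0"
  shows "\<forall>\<^sub>F t in at 0. ell_eval p t \<noteq> 0"
proof (cases "ell_eval p 0 = 0")
  case False
  have "(ell_eval p \<longlongrightarrow> ell_eval p 0) (at 0)"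
    using analytic_at_imp_isCont[OF ell_eval_analytic] by (simp add: isCont_def)
  then show ?thesis
    using False by (rule tendsto_imp_eventually_ne)
next
  case True
  have "((\<lambda>t. ell_eval p t / t) \<longlongrightarrow> 2 / E7s 0 * ell_eval (ell_deriv p) 0) (at 0)"
    using has_field_derivative_ell_eval[OF csqrt_arg_0, of p] True by (simp add: has_field_derivative_iff)
  then have "\<forall>\<^sub>F t in at 0. ell_eval p t / t \<noteq> 0"
    by (rule tendsto_imp_eventually_ne) (use assms True in \<open>auto simp: E7s_0\<close>)
  then show ?thesis
    by eventually_elim auto
qed

section \<open>Factors of the covering map and of the right-hand sides, with their logarithmic
  derivatives\<close>

definition c_u :: ell where
  "c_u = ([:0, 1/4:], 0)"

definition c_1m4u :: ell where
  "c_1m4u = ([:1, -1:], 0)"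

definition c_1m8u :: ell where
  "c_1m8u = ([:1, -2:], 0)"

definition c_F3 :: ell where
  "c_F3 = ([:1, -1:], [:-1:])"

definition c_F3t :: ell where
  "c_F3t = ([:1, -1:], [:1:])"

definition c_F4t :: ell where
  "c_F4t = ([:1, -3/2:], [:1/2:])"

definition c_G3 :: ell where
  "c_G3 = ([:1, -5/2, 1:], [:1/2:])"

definition c_G4 :: ell where
  "c_G4 = ([:1, -5, 4:], [:-1:])"

definition c_G4h :: ell where
  "c_G4h = ([:0, -5/4, 3/2:], [:1/4, -1/2:])"

definition c_H :: ell where
  "c_H = ([:0, -3/4, 5/4:], [:-1/4, 1/4:])"

definition c_vmu :: ell where
  "c_vmu = ([:0, -1/4:], [:1/4:])"

definition c_vpu :: ell where
  "c_vpu = ([:0, 1/4:], [:1/4:])"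

text \<open>Every divisor occurring below is supported on the zeros and poles of \<open>Phi7\<close>, and \<open>K7 = 4 (1 - 4u) (1 - 8u) G4 c_H\<close>
  vanishes on all of them except the point at infinity. Hence \<open>K7\<close> times the logarithmic derivative of any of the
  functions \<open>c_f\<close> is a polynomial in \<open>X\<close> and \<open>Y\<close>; it is recorded as \<open>l_f\<close>.\<close>

definition K7 :: ell where
  "K7 = ([:0, 1, 2, -31, 76, -72, 24:], [:-1, 12, -43, 64, -40, 8:])"

definition l_u :: ell where
  "l_u = ([:-4, 59, -312, 825, -1208, 984, -408, 64:], [:1, 2, -31, 76, -72, 24:])"

definition l_1m4u :: ell where
  "l_1m4u = ([:0, 4, -55, 257, -568, 640, -344, 64:], [:0, -1, -3, 28, -48, 24:])"

definition l_1m8u :: ell where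
  "l_1m8u = ([:0, 8, -102, 420, -810, 796, -376, 64:], [:0, -2, -8, 46, -60, 24:])"

definition l_F3 :: ell where
  "l_F3 = ([:0, 10, -160, 680, -1298, 1248, -576, 96:], [:2, -24, 44, 10, -64, 32:])"

definition l_F3t :: ell where
  "l_F3t = ([:0, 14, -146, 580, -1132, 1140, -552, 96:], [:-2, 18, -68, 128, -116, 40:])"

definition l_F4t :: ell where
  "l_F4t = ([:0, 9, -104, 437, -892, 948, -496, 96:], [:-1, 10, -51, 124, -132, 48:])"

definition l_G3 :: ell where
  "l_G3 = ([:0, 13, -144, 586, -1168, 1224, -640, 128:], [:-1, 6, -30, 80, -88, 32:])"

definition l_G4 :: ell where
  "l_G4 = ([:0, 26, -228, 808, -1470, 1432, -696, 128:], [:2, -4, -28, 110, -136, 56:])"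

definition l_G4h :: ell where
  "l_G4h = ([:-2, 53, -363, 1149, -1954, 1828, -872, 160:], [:3, -7, -35, 146, -180, 72:])"

definition l_H :: ell where
  "l_H = ([:-2, 45, -321, 1070, -1892, 1812, -872, 160:], [:-1, 11, -54, 120, -116, 40:])"

definition l_vmu :: ell where
  "l_vmu = ([:-2, 35, -237, 761, -1294, 1192, -552, 96:], [:1, -5, -15, 82, -104, 40:])"

definition l_vpu :: ell where
  "l_vpu = ([:-2, 36, -232, 741, -1292, 1228, -576, 96:], [:0, 4, -27, 68, -76, 32:])"

text \<open>\<open>2 S7\<close> is \<open>K7\<close> times the logarithmic derivative of \<open>Phi7\<close>; it vanishes at the ramification points above \<open>1\<close>.
  \<open>Z7 / A7\<close> is \<open>Phi7\<close> with polynomial numerator and denominator.\<close>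

definition S7 :: ell where
  "S7 = ([:-1, -24, 166, -402, 456, -224, 12, 16:], [:-12, 50, -42, -88, 184, -92:])"

definition A7 :: ell where
  "A7 = ([:2, 94, -2632, 29624, -203504, 978208, -3481856, 9325824, -18701824, 27643392, -29374464,
    21532672, -10063872, 2465792, -81920, -65536:], [:-14, 168, -168, -8976, 79264, -344192, 888320,
    -1360384, 991744, 339968, -1474560, 1404928, -630784, 114688:])"

definition Z7 :: ell where
  "Z7 = ([:0, -1344, 7616, 35392, -513600, 2472704, -7048384, 13642496, -19106304, 20074880, -16066176,
    9644416, -4060992, 1007104, -69888, -17920:], [:-64, -1984, 25664, -120896, 279808, -261056,
    -258432, 1086080, -1455360, 988160, -229888, -148544, 124416, -27392, -512:])"

text \<open>For the \<open>i\<close>-th right-hand side \<open>R\<close>, and \<open>\<theta> = z d/dz\<close> with \<open>z = Phi7\<close>, the pair \<open>Qij\<close> is the numerator in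
  \<open>(14 \<theta>)\<^sup>j R = Qij / S7\<^bsup>2j-1\<^esup> R\<close>.\<close>

definition Q11 :: ell where
  "Q11 = ([:0, -61, 471, -1474, 2392, -2112, 956, -176:], [:-11, 51, -54, -64, 152, -76:])"

definition Q12 :: ell where
  "Q12 = ([:0, -2038, -11550, 504764, -4982860, 29649772, -133963596, 512478784, -1710974832, 4896738080,
    -11667689120, 22622367936, -35125650464, 43101032704, -41198769920, 30107544448, -16378076160,
    6371256832, -1663143424, 261258240, -20063232, 495616:], [:-154, -8438, 184980, -2063916,
    16396556, -98123060, 446213536, -1556019296, 4204804288, -8871589920, 14648556800, -18858589856,
    18728721280, -14068031232, 7727767680, -2922800640, 669820416, -59219968, -7496704, 1477632:])"

definition Q13 :: ell where
  "Q13 = ([:0, 145292, -7096292, 131679064, -3358394144, 84252536032, -1409095050832, 16166851012032,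
    -136565104050368, 894932581169536, -4714518818600448, 20457194580114432, -74361131876404448,
    229140920411940800, -603685397627134784, 1368171306782042112, -2679270735321318656,
    4547524165923918848, -6702381751145755136, 8583461434075241984, -9544595730317712896,
    9193204598761749504, -7635269615632175104, 5428560234941362176, -3268538664937844736,
    1640630948063715328, -670943255572553728, 215852436520173568, -51498273200340992,
    8066439692910592, -542822110150656, -49700747083776, 7867740389376, 1020390539264,
    -175433318400, -1395654656:], [:-2156, 133836, -6341240, -84400000, 4827438144, -72021070896,
    546508006080, -1803677124224, -7584966036928, 144286657200192, -1085359711464384,
    5642644540276384, -22726645631873216, 74271660395656768, -201732673568643328,
    461876667641379584, -899318323592833536, 1497539077347319808, -2139815093273656832,
    2627608280589810176, -2772176862230785024, 2507404722797289472, -1935856571250167808,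
    1266700884875407360, -695016332541755392, 314872672864468992, -115195480831606784,
    32930474599546880, -6981280725008384, 996872860450816, -74293327626240, -1000783282176,
    614394757120, -32675463168:])"

definition Q21 :: ell where
  "Q21 = ([:0, 39, -290, 874, -1348, 1040, -300, -16:], [:13, -52, 18, 180, -312, 156:])"

definition Q22 :: ell where
  "Q22 = ([:0, 234, -87948, 1439708, -9297628, 19979588, 104516004, -1025814584, 4354036008,
    -11968414656, 23335683296, -33151321280, 34090089312, -24198322560, 10067273216, -362039936,
    -2333581312, 1382724096, -316825088, 1637376, 8322048, 4096:], [:182, -12584, 77300, 840556,
    -14059076, 91954044, -361171640, 943051288, -1673517696, 1938509088, -1200579200, -110498336,
    776879360, -259231488, -621994368, 885236224, -545010176, 171839488, -21980160, -332800:])"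

definition Q23 :: ell where
  "Q23 = ([:0, -250068, 4571672, 76820680, -897916824, -37782965080, 1038443883848, -13036764950384,
    105805589181264, -620335854795328, 2772328075855488, -9728066611891264, 27226333917589088,
    -61051083508653696, 108688491705771968, -148248937898304768, 137220428741251072,
    -33835415217938176, -166061766939002368, 408650268394309120, -605624365001330688,
    688183723660407808, -645453781947957248, 517998922484248576, -362321775868805120,
    221400197087096832, -116355520581480448, 50804713032892416, -17408527224455168,
    4230773638332416, -553644771033088, -27369644752896, 23603667075072, -3001781846016,
    39780089856, -1048576:], [:2548, -982384, 33450680, -222706504, -3424337192, 62106989240,
    -263969439152, -2521580490768, 46335517977728, -377282814437568, 2082894822749056,
    -8701899544967072, 28941002480598784, -78932312475946816, 180071300032573440,
    -348567018720747520, 578634046848974592, -830192047870880768, 1034705532793659904,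
    -1122693633209949184, 1059289410082042880, -864797316750942208, 605107831693537280,
    -357409931922243584, 174086854623825920, -67354770127310848, 19330801354031104,
    -3474400099090432, 112636626075648, 121956845240320, -29089873592320, 1673695920128,
    152009441280, 1040973824:])"

definition Q31 :: ell where
  "Q31 = ([:0, 176, -1133, 2770, -3172, 1520, -12, -144:], [:68, -307, 302, 444, -1016, 508:])"

definition Q32 :: ell where
  "Q32 = ([:0, -14520, -1564374, 29840512, -235853872, 1035417120, -2603629484, 2667665544, 5450888968,
    -27340182080, 53158422080, -54194033600, 10699795424, 54878991360, -92596889728, 79472583040,
    -40326829056, 10520551936, 500224, -759759872, 143768576, 331776:], [:952, -269954, 3051688,
    -8798288, -48293824, 505172892, -2055080904, 4837719112, -6568285824, 2914833088, 7050731008,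
    -16132008608, 14916094080, -3742504576, -6831094656, 9023099392, -5259194880, 1596547072,
    -198616064, -3101696:])"

definition Q33 :: ell where
  "Q33 = ([:0, -1958320, 106686132, 9712720464, -292669789888, 3589484447360, -24298242505992,
    87930981484528, -22284405338832, -1719507418104896, 11467007357877312, -45260129546696512,
    127810651972010464, -274117359383488064, 462770655813625856, -654581726756785408,
    905550807292646144, -1485435087709880576, 2756435940360994304, -4715378545069486080,
    6602950354156506624, -7210896752048815104, 5872021398677934080, -3177001955514032128,
    556418685641310208, 887248159896268800, -1082975932405542912, 670177185468727296,
    -256163184574676992, 52542806641704960, 1067627776983040, -3868850759401472, 978875878801408,
    -84762956136448, -1016993677312, -764411904:], [:13328, -12597316, 1450151840, -20679491776,
    18232070336, 2145854311400, -26736386138160, 177114039029232, -762268783277568,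
    2191749488473856, -3734417419595008, 485953906771680, 18523657418376000, -62804869626463872,
    119863303359656704, -142063556661113088, 79305756069430016, 44032539297548288,
    -94594221551792128, -70518879681230336, 431714543363693568, -766746034588479488,
    835805024717635584, -606035577885032448, 262671224881967104, -13788873363779584,
    -73835185831264256, 60912897490862080, -27067385464815616, 7341156970086400, -1109599023333376,
    56524910952448, 4010664263680, 4843110400:])"

lemmas factor_defs = c_u_def c_1m4u_def c_1m8u_def c_F3_def c_F3t_def c_F4t_def c_G3_def c_G4_def c_G4h_def c_H_def c_vmu_def c_vpu_def

lemmas logderiv_coeff_defs = l_u_def l_1m4u_def l_1m8u_def l_F3_def l_F3t_def l_F4t_def l_G3_def l_G4_def l_G4h_def l_H_def l_vmu_def l_vpu_def S7_def Q11_def Q21_def Q31_def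

lemma ell_eval_u: "ell_eval c_u t = E7u t"
  by (simp add: ell_eval_def c_u_def E7u_def E7v_def E7s_def F3_def F3t_def F4t_def G3_def G4_def G4h_def algebra_simps power2_eq_square)

lemma ell_eval_1m4u: "ell_eval c_1m4u t = 1 - 4 * E7u t"
  by (simp add: ell_eval_def c_1m4u_def E7u_def E7v_def E7s_def F3_def F3t_def F4t_def G3_def G4_def G4h_def algebra_simps power2_eq_square)

lemma ell_eval_1m8u: "ell_eval c_1m8u t = 1 - 8 * E7u t"
  by (simp add: ell_eval_def c_1m8u_def E7u_def E7v_def E7s_def F3_def F3t_def F4t_def G3_def G4_def G4h_def algebra_simps power2_eq_square)

lemma ell_eval_F3: "ell_eval c_F3 t = F3 (E7u t) (E7v t)"
  by (simp add: ell_eval_def c_F3_def E7u_def E7v_def E7s_def F3_def F3t_def F4t_def G3_def G4_def G4h_def algebra_simps power2_eq_square)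

lemma ell_eval_F3t: "ell_eval c_F3t t = F3t (E7u t) (E7v t)"
  by (simp add: ell_eval_def c_F3t_def E7u_def E7v_def E7s_def F3_def F3t_def F4t_def G3_def G4_def G4h_def algebra_simps power2_eq_square)

lemma ell_eval_F4t: "ell_eval c_F4t t = F4t (E7u t) (E7v t)"
  by (simp add: ell_eval_def c_F4t_def E7u_def E7v_def E7s_def F3_def F3t_def F4t_def G3_def G4_def G4h_def algebra_simps power2_eq_square)

lemma ell_eval_G3: "ell_eval c_G3 t = G3 (E7u t) (E7v t)"
  by (simp add: ell_eval_def c_G3_def E7u_def E7v_def E7s_def F3_def F3t_def F4t_def G3_def G4_def G4h_def algebra_simps power2_eq_square)

lemma ell_eval_G4: "ell_eval c_G4 t = G4 (E7u t) (E7v t)"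
  by (simp add: ell_eval_def c_G4_def E7u_def E7v_def E7s_def F3_def F3t_def F4t_def G3_def G4_def G4h_def algebra_simps power2_eq_square)

lemma ell_eval_G4h: "ell_eval c_G4h t = G4h (E7u t) (E7v t)"
  by (simp add: ell_eval_def c_G4h_def E7u_def E7v_def E7s_def F3_def F3t_def F4t_def G3_def G4_def G4h_def algebra_simps power2_eq_square)

lemma ell_eval_H: "ell_eval c_H t = - E7v t - 3 * E7u t + 4 * E7u t * E7v t + 20 * E7u t ^ 2"
  by (simp add: ell_eval_def c_H_def E7u_def E7v_def E7s_def F3_def F3t_def F4t_def G3_def G4_def G4h_def algebra_simps power2_eq_square)

lemma ell_eval_vmu: "ell_eval c_vmu t = E7v t - E7u t"
  by (simp add: ell_eval_def c_vmu_def E7u_def E7v_def E7s_def F3_def F3t_def F4t_def G3_def G4_def G4h_def algebra_simps power2_eq_square)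

lemma ell_eval_vpu: "ell_eval c_vpu t = E7v t + E7u t"
  by (simp add: ell_eval_def c_vpu_def E7u_def E7v_def E7s_def F3_def F3t_def F4t_def G3_def G4_def G4h_def algebra_simps power2_eq_square)

lemma K7_ell_deriv_u: "ell_mul K7 (ell_deriv c_u) = ell_mul l_u c_u"
  by (simp add: ell_mul_def ell_deriv_def K7_def c_u_def l_u_def pderiv_pCons)

lemma K7_ell_deriv_1m4u: "ell_mul K7 (ell_deriv c_1m4u) = ell_mul l_1m4u c_1m4u"
  by (simp add: ell_mul_def ell_deriv_def K7_def c_1m4u_def l_1m4u_def pderiv_pCons)

lemma K7_ell_deriv_1m8u: "ell_mul K7 (ell_deriv c_1m8u) = ell_mul l_1m8u c_1m8u"
  by (simp add: ell_mul_def ell_deriv_def K7_def c_1m8u_def l_1m8u_def pderiv_pCons)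

lemma K7_ell_deriv_F3: "ell_mul K7 (ell_deriv c_F3) = ell_mul l_F3 c_F3"
  by (simp add: ell_mul_def ell_deriv_def K7_def c_F3_def l_F3_def pderiv_pCons)

lemma K7_ell_deriv_F3t: "ell_mul K7 (ell_deriv c_F3t) = ell_mul l_F3t c_F3t"
  by (simp add: ell_mul_def ell_deriv_def K7_def c_F3t_def l_F3t_def pderiv_pCons)

lemma K7_ell_deriv_F4t: "ell_mul K7 (ell_deriv c_F4t) = ell_mul l_F4t c_F4t"
  by (simp add: ell_mul_def ell_deriv_def K7_def c_F4t_def l_F4t_def pderiv_pCons)

lemma K7_ell_deriv_G3: "ell_mul K7 (ell_deriv c_G3) = ell_mul l_G3 c_G3"
  by (simp add: ell_mul_def ell_deriv_def K7_def c_G3_def l_G3_def pderiv_pCons)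

lemma K7_ell_deriv_G4: "ell_mul K7 (ell_deriv c_G4) = ell_mul l_G4 c_G4"
  by (simp add: ell_mul_def ell_deriv_def K7_def c_G4_def l_G4_def pderiv_pCons)

lemma K7_ell_deriv_G4h: "ell_mul K7 (ell_deriv c_G4h) = ell_mul l_G4h c_G4h"
  by (simp add: ell_mul_def ell_deriv_def K7_def c_G4h_def l_G4h_def pderiv_pCons)

lemma K7_ell_deriv_H: "ell_mul K7 (ell_deriv c_H) = ell_mul l_H c_H"
  by (simp add: ell_mul_def ell_deriv_def K7_def c_H_def l_H_def pderiv_pCons)

lemma K7_ell_deriv_vmu: "ell_mul K7 (ell_deriv c_vmu) = ell_mul l_vmu c_vmu"
  by (simp add: ell_mul_def ell_deriv_def K7_def c_vmu_def l_vmu_def pderiv_pCons)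

lemma K7_ell_deriv_vpu: "ell_mul K7 (ell_deriv c_vpu) = ell_mul l_vpu c_vpu"
  by (simp add: ell_mul_def ell_deriv_def K7_def c_vpu_def l_vpu_def pderiv_pCons)

section \<open>Logarithmic derivatives at generic points near the base point\<close>

definition regular :: "complex \<Rightarrow> bool" where
  "regular t \<longleftrightarrow> t \<noteq> 0 \<and> 1 - 11 * t ^ 2 + 32 * t ^ 4 \<notin> \<real>\<^sub>\<le>\<^sub>0 \<and> ell_eval S7 t \<noteq> 0
    \<and> (\<forall>c \<in> {c_u, c_1m4u, c_1m8u, c_F3, c_F3t, c_F4t, c_G3, c_G4, c_G4h, c_H, c_vmu, c_vpu}. ell_eval c t \<noteq> 0)"

lemma eventually_regular: "\<forall>\<^sub>F t in at 0. regular t"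
proof -
  have "\<forall>\<^sub>F t in at 0. (t :: complex) \<noteq> 0"
    by (simp add: eventually_at_filter)
  \<comment> \<open>\<open>c_u\<close> has a double zero at the base point, which the test for
    simple zeros cannot handle.\<close>
  moreover from this have "\<forall>\<^sub>F t in at 0. ell_eval c_u t \<noteq> 0"
    by eventually_elim (simp add: ell_eval_def c_u_def)
  moreover have "\<forall>\<^sub>F t in at 0. (1 :: complex) - 11 * t ^ 2 + 32 * t ^ 4 \<notin> \<real>\<^sub>\<le>\<^sub>0"
    using eventually_csqrt_arg by (rule filter_leD[OF at_within_le_nhds])
  moreover have "\<forall>\<^sub>F t in at 0. ell_eval c t \<noteq> 0"
    if "c \<in> {S7, c_1m4u, c_1m8u, c_F3, c_F3t, c_F4t, c_G3, c_G4, c_G4h, c_H, c_vmu, c_vpu}" for c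
    using that by (intro eventually_ell_eval_nonzero)
      (auto simp: ell_eval_def ell_deriv_def factor_defs S7_def pderiv_pCons)
  ultimately show ?thesis
    unfolding regular_def by (simp add: eventually_conj_iff)
qed

lemma ell_eval_K7: "ell_eval K7 t = 4 * ell_eval c_H t * ell_eval c_G4 t * ell_eval c_1m4u t * ell_eval c_1m8u t"
proof -
  have K7: "K7 = ell_mul (ell_mul (ell_scale 4 c_H) c_G4) (ell_mul c_1m4u c_1m8u)"
    by (simp add: K7_def ell_mul_def ell_scale_def factor_defs)
  show ?thesis
    unfolding K7 ell_eval_simps by (simp only: mult_ac)
qed

text \<open>Converts \<open>K7\<close> times a logarithmic derivative for \<open>ell_deriv\<close> into a logarithmic derivative in \<open>t\<close>;
  note that \<open>ell_deriv\<close> is \<open>(E7s / 2) d/dt\<close>.\<close>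

definition kfac :: "complex \<Rightarrow> complex" where
  "kfac t = 2 / (E7s t * ell_eval K7 t)"

lemma regular_imp_nonzero:
  assumes "regular t"
  shows "E7s t \<noteq> 0" "ell_eval K7 t \<noteq> 0" "kfac t \<noteq> 0" "ell_eval S7 t \<noteq> 0"
  using assms by (auto simp: regular_def kfac_def ell_eval_K7 E7s_def)

lemma has_logderiv_ell_eval:
  assumes t: "regular t" "ell_eval c t \<noteq> 0" and l: "ell_mul K7 (ell_deriv c) = ell_mul l c"
  shows "has_logderiv (ell_eval c) (kfac t * ell_eval l t) t"
proof -
  have "ell_eval K7 t * ell_eval (ell_deriv c) t = ell_eval l t * ell_eval c t"
    using l by (metis ell_eval_mul)
  then have "2 / E7s t * ell_eval (ell_deriv c) t = kfac t * ell_eval l t * ell_eval c t"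
    using regular_imp_nonzero[OF t(1)] by (simp add: kfac_def field_simps)
  then show ?thesis
    using has_field_derivative_ell_eval[of t c] t unfolding has_logderiv_def regular_def by auto
qed

lemma has_logderiv_u:
  assumes "regular t"
  shows "has_logderiv (ell_eval c_u) (kfac t * ell_eval l_u t) t"
  using has_logderiv_ell_eval[OF assms _ K7_ell_deriv_u] assms unfolding regular_def by blast

lemma has_logderiv_1m4u:
  assumes "regular t"
  shows "has_logderiv (ell_eval c_1m4u) (kfac t * ell_eval l_1m4u t) t"
  using has_logderiv_ell_eval[OF assms _ K7_ell_deriv_1m4u] assms unfolding regular_def by blast

lemma has_logderiv_1m8u:
  assumes "regular t"
  shows "has_logderiv (ell_eval c_1m8u) (kfac t * ell_eval l_1m8u t) t"
  using has_logderiv_ell_eval[OF assms _ K7_ell_deriv_1m8u] assms unfolding regular_def by blast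

lemma has_logderiv_F3:
  assumes "regular t"
  shows "has_logderiv (ell_eval c_F3) (kfac t * ell_eval l_F3 t) t"
  using has_logderiv_ell_eval[OF assms _ K7_ell_deriv_F3] assms unfolding regular_def by blast

lemma has_logderiv_F3t:
  assumes "regular t"
  shows "has_logderiv (ell_eval c_F3t) (kfac t * ell_eval l_F3t t) t"
  using has_logderiv_ell_eval[OF assms _ K7_ell_deriv_F3t] assms unfolding regular_def by blast

lemma has_logderiv_F4t:
  assumes "regular t"
  shows "has_logderiv (ell_eval c_F4t) (kfac t * ell_eval l_F4t t) t"
  using has_logderiv_ell_eval[OF assms _ K7_ell_deriv_F4t] assms unfolding regular_def by blast

lemma has_logderiv_G3:
  assumes "regular t"
  shows "has_logderiv (ell_eval c_G3) (kfac t * ell_eval l_G3 t) t"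
  using has_logderiv_ell_eval[OF assms _ K7_ell_deriv_G3] assms unfolding regular_def by blast

lemma has_logderiv_G4:
  assumes "regular t"
  shows "has_logderiv (ell_eval c_G4) (kfac t * ell_eval l_G4 t) t"
  using has_logderiv_ell_eval[OF assms _ K7_ell_deriv_G4] assms unfolding regular_def by blast

lemma has_logderiv_G4h:
  assumes "regular t"
  shows "has_logderiv (ell_eval c_G4h) (kfac t * ell_eval l_G4h t) t"
  using has_logderiv_ell_eval[OF assms _ K7_ell_deriv_G4h] assms unfolding regular_def by blast

lemma has_logderiv_H:
  assumes "regular t"
  shows "has_logderiv (ell_eval c_H) (kfac t * ell_eval l_H t) t"
  using has_logderiv_ell_eval[OF assms _ K7_ell_deriv_H] assms unfolding regular_def by blast

lemma has_logderiv_vmu: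
  assumes "regular t"
  shows "has_logderiv (ell_eval c_vmu) (kfac t * ell_eval l_vmu t) t"
  using has_logderiv_ell_eval[OF assms _ K7_ell_deriv_vmu] assms unfolding regular_def by blast

lemma has_logderiv_vpu:
  assumes "regular t"
  shows "has_logderiv (ell_eval c_vpu) (kfac t * ell_eval l_vpu t) t"
  using has_logderiv_ell_eval[OF assms _ K7_ell_deriv_vpu] assms unfolding regular_def by blast

lemmas has_logderiv_factors = has_logderiv_u has_logderiv_1m4u has_logderiv_1m8u has_logderiv_F3 has_logderiv_F3t has_logderiv_F4t has_logderiv_G3 has_logderiv_G4 has_logderiv_G4h has_logderiv_H has_logderiv_vmu has_logderiv_vpu


section \<open>The covering map and the pulled-back operator\<close>

lemma ell_eval_factors_0:
  "ell_eval c_1m4u 0 = 1" "ell_eval c_1m8u 0 = 1" "ell_eval c_F3 0 = 1" "ell_eval c_F3t 0 = 1"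
  "ell_eval c_F4t 0 = 1" "ell_eval c_G3 0 = 1" "ell_eval c_G4 0 = 1"
  by (simp_all add: ell_eval_def factor_defs)

abbreviation (input) phi7 :: "complex \<Rightarrow> complex" where
  "phi7 t \<equiv> Phi7 (E7u t) (E7v t)"

lemma phi7_eq:
  "phi7 t = t * (128 * (1 - 4 * t ^ 2) * (- E7s t - 3 * t + 4 * t ^ 2 * E7s t + 20 * t ^ 3) ^ 7
      / ((1 - 8 * t ^ 2) * ell_eval c_G4 t ^ 7))"
proof (cases "t = 0")
  \<comment> \<open>The quotient defining \<open>Phi7\<close> is 0/0 here; its default value 0 is
    also the value of the holomorphic extension.\<close>
  case True
  then show ?thesis
    by (simp add: Phi7_def E7u_def)
next
  case False
  define w where "w = - E7s t - 3 * t + 4 * t ^ 2 * E7s t + 20 * t ^ 3"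
  have "- E7v t - 3 * E7u t + 4 * E7u t * E7v t + 20 * E7u t ^ 2 = t * w"
    by (simp add: w_def E7u_def E7v_def E7s_def algebra_simps power_numeral_even power_numeral_odd)
  then have "phi7 t = 128 * (1 - 4 * t ^ 2) * (t * w) ^ 7 / ((t ^ 2) ^ 3 * (1 - 8 * t ^ 2) * ell_eval c_G4 t ^ 7)"
    by (simp add: Phi7_def ell_eval_G4 G4_def E7u_def)
  also have "(t * w) ^ 7 = (t ^ 2) ^ 3 * (t * w ^ 7)"
    by algebra
  finally show ?thesis
    using False by (simp add: w_def)
qed

lemma phi7_cofactor_analytic:
  "(\<lambda>t. 128 * (1 - 4 * t ^ 2) * (- E7s t - 3 * t + 4 * t ^ 2 * E7s t + 20 * t ^ 3) ^ 7
      / ((1 - 8 * t ^ 2) * ell_eval c_G4 t ^ 7)) analytic_on {0}"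
  by (intro analytic_intros E7s_analytic ell_eval_analytic) (auto simp: ell_eval_factors_0)

lemma phi7_analytic: "phi7 analytic_on {0}"
  unfolding phi7_eq by (intro analytic_on_mult analytic_on_ident phi7_cofactor_analytic)

lemma phi7_0: "phi7 0 = 0"
  by (simp add: phi7_eq)

lemma deriv_phi7_0: "deriv phi7 0 \<noteq> 0"
proof -
  define w where "w = (\<lambda>t. 128 * (1 - 4 * t ^ 2) * (- E7s t - 3 * t + 4 * t ^ 2 * E7s t + 20 * t ^ 3) ^ 7
      / ((1 - 8 * t ^ 2) * ell_eval c_G4 t ^ 7))"
  have "w field_differentiable at 0"
    using phi7_cofactor_analytic unfolding w_def by (rule analytic_on_imp_differentiable_at) simp
  then have "((\<lambda>t. t * w t) has_field_derivative 1 * w 0 + deriv w 0 * 0) (at 0)"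
    by (intro DERIV_mult DERIV_ident) (simp add: DERIV_deriv_iff_field_differentiable)
  moreover have "phi7 = (\<lambda>t. t * w t)"
    unfolding w_def phi7_eq ..
  ultimately have "deriv phi7 0 = w 0"
    by (metis DERIV_imp_deriv add.right_neutral mult_1 mult_zero_right)
  also have "\<dots> = - 128"
    by (simp add: w_def E7s_0 ell_eval_factors_0)
  finally show ?thesis by simp
qed

lemma phi7_eq_factors:
  "phi7 t = 128 * ell_eval c_1m4u t * ell_eval c_H t ^ 7
      / (ell_eval c_u t ^ 3 * ell_eval c_1m8u t * ell_eval c_G4 t ^ 7)"
  unfolding Phi7_def ell_eval_1m4u ell_eval_H ell_eval_u ell_eval_1m8u ell_eval_G4 G4_def ..

lemma has_logderiv_phi7:
  assumes "regular t"
  shows "has_logderiv phi7 (kfac t * (2 * ell_eval S7 t)) t"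
proof -
  have "has_logderiv phi7 (0 + kfac t * ell_eval l_1m4u t + of_nat 7 * (kfac t * ell_eval l_H t)
      - (of_nat 3 * (kfac t * ell_eval l_u t) + kfac t * ell_eval l_1m8u t
        + of_nat 7 * (kfac t * ell_eval l_G4 t))) t"
    unfolding phi7_eq_factors
    by (intro has_logderiv_intros has_logderiv_factors assms) simp
  moreover have "ell_scale 2 S7 = l_1m4u + ell_scale 7 l_H - ell_scale 3 l_u - l_1m8u - ell_scale 7 l_G4"
    by (simp add: ell_scale_def logderiv_coeff_defs)
  then have *: "2 * ell_eval S7 t = ell_eval l_1m4u t + 7 * ell_eval l_H t - 3 * ell_eval l_u t
      - ell_eval l_1m8u t - 7 * ell_eval l_G4 t"
    by (metis ell_eval_simps)
  have "kfac t * (2 * ell_eval S7 t) = 0 + kfac t * ell_eval l_1m4u t + of_nat 7 * (kfac t * ell_eval l_H t)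
      - (of_nat 3 * (kfac t * ell_eval l_u t) + kfac t * ell_eval l_1m8u t
        + of_nat 7 * (kfac t * ell_eval l_G4 t))"
    unfolding * by (simp add: algebra_simps)
  ultimately show ?thesis
    by (simp only:)
qed

lemma A7_phi7:
  assumes "regular t"
  shows "ell_eval A7 t \<noteq> 0" "ell_eval A7 t * phi7 t = ell_eval Z7 t"
proof -
  have nz: "ell_eval c_u t \<noteq> 0" "ell_eval c_1m8u t \<noteq> 0" "ell_eval c_G4 t \<noteq> 0"
    using assms by (auto simp: regular_def)
  have A7: "A7 = ell_scale 2 (ell_mul c_1m8u (ell_mul c_G4 (ell_mul (ell_mul c_G4 (ell_mul c_G4 c_G4))
      (ell_mul c_G4 (ell_mul c_G4 c_G4)))))"
    by (simp add: A7_def ell_mul_def ell_scale_def factor_defs)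
  have A7': "ell_eval A7 t = 2 * ell_eval c_1m8u t * ell_eval c_G4 t ^ 7"
    unfolding A7 ell_eval_simps by algebra
  then show "ell_eval A7 t \<noteq> 0"
    using nz by simp
  \<comment> \<open>Scaling \<open>c_u\<close> and \<open>c_H\<close> by 4 clears their fractions
    and turns the constant 128 into \<open>128 * 4 ^ 3 / 4 ^ 7 = 1 / 2\<close>, whence the factor 2
    in \<open>A7\<close>.\<close>
  define x where "x = ell_scale 4 c_u"
  define y where "y = ell_scale 4 c_H"
  have xy: "x = ([:0, 1:], 0)" "y = ([:0, -3, 5:], [:-1, 1:])"
    by (simp_all add: x_def y_def ell_scale_def factor_defs)
  \<comment> \<open>The only zero of \<open>x\<close> is the base point, where \<open>x ^ 3\<close>
    has order 6 and \<open>y ^ 7\<close> order 7. Hence the quotient \<open>Z7\<close> is again a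
    polynomial in \<open>X\<close> and \<open>Y\<close>.\<close>
  have Z7: "ell_mul (ell_mul x (ell_mul x x)) Z7
      = ell_mul c_1m4u (ell_mul y (ell_mul (ell_mul y (ell_mul y y)) (ell_mul y (ell_mul y y))))"
    by (simp add: Z7_def ell_mul_def xy c_1m4u_def)
  have "ell_eval c_u t ^ 3 * ell_eval Z7 t = 256 * ell_eval c_1m4u t * ell_eval c_H t ^ 7"
    using arg_cong[OF Z7, of "\<lambda>p. ell_eval p t"] unfolding x_def y_def ell_eval_simps by algebra
  moreover have "2 * q * r ^ 7 * (128 * a * h ^ 7 / (p ^ 3 * q * r ^ 7)) = z"
    if "p \<noteq> 0" "q \<noteq> 0" "r \<noteq> 0" "p ^ 3 * z = 256 * a * h ^ 7" for a h p q r z :: complex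
    using that by (simp add: divide_eq_eq mult_ac)
  ultimately show "ell_eval A7 t * phi7 t = ell_eval Z7 t"
    unfolding A7' phi7_eq_factors using nz by (simp only: not_False_eq_True)
qed

text \<open>This is \<open>1 - Phi7\<close> over the denominator \<open>A7\<close>. As
  \<open>c_F3t\<close> vanishes only at \<open>u = 1/8\<close>, \<open>v = -1/8\<close>, a pole of
  \<open>Phi7\<close>, the square explains the even ramification above 1; it also cancels from the
  differential equation later.\<close>

lemma A7_minus_Z7: "A7 - Z7 = ell_scale 2 (ell_mul c_F3t (ell_mul S7 S7))"
  by (simp add: A7_def Z7_def S7_def c_F3t_def ell_mul_def ell_scale_def)

text \<open>The numerator of \<open>14 \<theta>\<close> applied to \<open>Q / S7\<^sup>m R\<close>, over the denominator \<open>S7\<^bsup>m+2\<^esup>\<close>, where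
  \<open>q / S7\<close> is the logarithmic \<open>14 \<theta>\<close>-derivative of \<open>R\<close>.\<close>

definition ell_theta :: "ell \<Rightarrow> nat \<Rightarrow> ell \<Rightarrow> ell" where
  "ell_theta q m Q = ell_mul K7 (ell_scale 7 (ell_mul S7 (ell_deriv Q) - ell_scale (of_nat m) (ell_mul Q (ell_deriv S7))))
     + ell_mul S7 (ell_mul Q q)"

text \<open>Since \<open>kfac t * (2 * ell_eval S7 t)\<close> is the logarithmic derivative of
  \<open>phi7\<close>, its cofactor here is the \<open>\<theta>\<close>-derivative.\<close>

lemma has_field_derivative_ell_theta:
  assumes t: "regular t" and R: "has_logderiv R (kfac t * ell_eval q t / 7) t"
  shows "((\<lambda>t. ell_eval Q t / ell_eval S7 t ^ m * R t) has_field_derivative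
    kfac t * (2 * ell_eval S7 t) * (ell_eval (ell_theta q m Q) t / (14 * ell_eval S7 t ^ (m + 2)) * R t)) (at t)"
proof -
  note nz = regular_imp_nonzero[OF t]
  have c: "1 - 11 * t ^ 2 + 32 * t ^ 4 \<notin> \<real>\<^sub>\<le>\<^sub>0"
    using t by (simp add: regular_def)
  define S where "S = ell_eval S7 t"
  define dS where "dS = ell_eval (ell_deriv S7) t"
  define dQ where "dQ = ell_eval (ell_deriv Q) t"
  define K where "K = ell_eval K7 t"
  define s where "s = E7s t"
  have nz': "S \<noteq> 0" "K \<noteq> 0" "s \<noteq> 0"
    using nz by (simp_all add: S_def K_def s_def)
  \<comment> \<open>For \<open>m = 0\<close> the truncated exponent \<open>m - Suc 0\<close> does no
    harm, as both sides are 0.\<close>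
  have m: "of_nat m * S ^ (m - Suc 0) = of_nat m * S ^ m / S"
    using nz'(1) by (cases m) simp_all
  have "((\<lambda>t. ell_eval Q t / ell_eval S7 t ^ m * R t) has_field_derivative
     (2 / s * dQ * S ^ m - ell_eval Q t * (of_nat m * (2 / s * dS * S ^ (m - Suc 0)))) / (S ^ m * S ^ m) * R t
      + kfac t * ell_eval q t / 7 * R t * (ell_eval Q t / S ^ m)) (at t)"
    using has_field_derivative_ell_eval[OF c] R nz unfolding S_def dS_def dQ_def s_def has_logderiv_def
    by (intro DERIV_mult DERIV_divide DERIV_power) auto
  also have "(2 / s * dQ * S ^ m - ell_eval Q t * (of_nat m * (2 / s * dS * S ^ (m - Suc 0)))) / (S ^ m * S ^ m) * R t
      + kfac t * ell_eval q t / 7 * R t * (ell_eval Q t / S ^ m)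
    = kfac t * (2 * S) * ((K * (7 * (S * dQ - of_nat m * (ell_eval Q t * dS))) + S * (ell_eval Q t * ell_eval q t))
       / (14 * S ^ (m + 2)) * R t)"
  proof -
    have "of_nat m * (2 / s * dS * S ^ (m - Suc 0)) = of_nat m * (2 / s * dS) * S ^ m / S"
    proof -
      have "of_nat m * (2 / s * dS * S ^ (m - Suc 0)) = of_nat m * S ^ (m - Suc 0) * (2 / s * dS)"
        by (simp only: mult_ac)
      then show ?thesis
        by (simp add: m mult_ac)
    qed
    then show ?thesis
      using nz' by (auto simp: kfac_def K_def[symmetric] s_def[symmetric] field_simps)
  qed
  finally show ?thesis
    unfolding ell_theta_def ell_eval_simps S_def K_def dS_def dQ_def .
qed

text \<open>All parameters are scaled by 14, with \<open>e\<close> and \<open>f\<close> equal to 14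
  times the lower parameters minus 14. The logarithmic derivatives of \<open>h\<close> and
  \<open>phi7\<close> have quotient \<open>Q1 / S7\<close>, which is therefore the logarithmic
  \<open>14 \<theta>\<close>-derivative of the root \<open>R\<close>. The condition
  \<open>h 0 = 1\<close> makes the principal branch of the root holomorphic near 0.\<close>

lemma hyp3F2_phi7:
  assumes h: "h analytic_on {0}" "h 0 = 1"
    and logderiv: "\<And>t. regular t \<Longrightarrow> has_logderiv h (kfac t * (2 * ell_eval Q1 t)) t"
    and Q2: "ell_theta Q1 1 Q1 = Q2" and Q3: "ell_theta Q1 3 Q2 = Q3"
    and ode: "ell_scale 2 (ell_mul c_F3t Q3)
      + ell_mul (ell_scale (e + f) A7 - ell_scale (a + b + c) Z7) Q2
      + ell_mul (ell_mul (ell_scale (e * f) A7 - ell_scale (a * b + a * c + b * c) Z7) Q1) (ell_mul S7 S7)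
      - ell_mul (ell_scale (a * b * c) Z7) (ell_mul S7 (ell_mul S7 S7)) = 0"
    and e: "14 + e = of_nat i" "i > 0" and f: "14 + f = of_nat j" "j > 0"
  shows "\<exists>R. R analytic_on {0} \<and> R 0 = 1 \<and> (\<forall>\<^sub>F t in nhds 0. R t ^ 14 = h t)
    \<and> (\<forall>\<^sub>F t in nhds 0. hyp3F2 (a / 14) (b / 14) (c / 14) (1 + e / 14) (1 + f / 14) (phi7 t) = R t)"
proof -
  define R where "R = (\<lambda>t. exp (Ln (h t) / 14))"
  have R_an: "R analytic_on {0}"
    unfolding R_def using h by (auto intro!: analytic_intros)
  have R0: "R 0 = 1"
    by (simp add: R_def h)
  have "isCont h 0"
    using h(1) analytic_at_imp_isCont by blast
  then have "(h \<longlongrightarrow> 1) (nhds 0)"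
    using h(2) by (simp add: isCont_def tendsto_nhds_iff)
  then have "\<forall>\<^sub>F t in nhds 0. h t \<in> - \<real>\<^sub>\<le>\<^sub>0"
    by (rule topological_tendstoD) (auto simp: open_Compl)
  then have slit: "\<forall>\<^sub>F t in nhds 0. h t \<notin> \<real>\<^sub>\<le>\<^sub>0"
    by simp
  then have R14: "\<forall>\<^sub>F t in nhds 0. R t ^ 14 = h t"
  proof eventually_elim
    case (elim t)
    then have "h t \<noteq> 0"
      by auto
    then show ?case
      by (simp add: R_def exp_of_nat_mult[symmetric])
  qed
  have ev: "\<forall>\<^sub>F t in at 0. regular t \<and> has_logderiv R (kfac t * ell_eval Q1 t / 7) t"
    using eventually_regular filter_leD[OF at_within_le_nhds slit]
  proof eventually_elim
    case (elim t)
    then show ?case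
      using has_logderiv_root[OF logderiv[OF elim(1)] elim(2), of 14] by (simp add: R_def)
  qed
  \<comment> \<open>\<open>T j (2 * j - 1)\<close> applied to the \<open>j\<close>-th numerator is
    the \<open>j\<close>-th \<open>\<theta>\<close>-derivative of \<open>R\<close>; each step adds 2
    to the exponent of \<open>S7\<close>.\<close>
  define T where "T n m Q t = ell_eval Q t / ell_eval S7 t ^ m * R t / 14 ^ n" for n m Q t
  have S0: "ell_eval S7 0 \<noteq> 0"
    by (simp add: ell_eval_def S7_def)
  have T_an: "T n m Q analytic_on {0}" for n m Q
    unfolding T_def using S0 by (auto intro!: analytic_intros ell_eval_analytic R_an)
  have step: "\<forall>\<^sub>F t in at 0. phi7 t * deriv (T n m Q) t = deriv phi7 t * T (Suc n) (m + 2) (ell_theta Q1 m Q) t" for n m Q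
    using ev
  proof eventually_elim
    case (elim t)
    have "(T n m Q has_field_derivative kfac t * (2 * ell_eval S7 t) *
        (ell_eval (ell_theta Q1 m Q) t / (14 * ell_eval S7 t ^ (m + 2)) * R t) / 14 ^ n) (at t)"
      unfolding T_def using elim by (intro DERIV_cdivide has_field_derivative_ell_theta) auto
    then have "deriv (T n m Q) t = kfac t * (2 * ell_eval S7 t) * T (Suc n) (m + 2) (ell_theta Q1 m Q) t"
      by (simp add: T_def DERIV_imp_deriv)
    moreover have "deriv phi7 t = kfac t * (2 * ell_eval S7 t) * phi7 t"
      using has_logderiv_phi7 elim by (simp add: has_logderiv_def DERIV_imp_deriv)
    ultimately show ?case by simp
  qed
  have step0: "\<forall>\<^sub>F t in at 0. phi7 t * deriv R t = deriv phi7 t * T 1 1 Q1 t"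
    using ev
  proof eventually_elim
    case (elim t)
    have "deriv R t = kfac t * ell_eval Q1 t / 7 * R t"
      using elim unfolding has_logderiv_def by (blast intro: DERIV_imp_deriv)
    moreover have "deriv phi7 t = kfac t * (2 * ell_eval S7 t) * phi7 t"
      using has_logderiv_phi7 elim by (simp add: has_logderiv_def DERIV_imp_deriv)
    ultimately show ?case
      using regular_imp_nonzero(4)[of t] elim by (simp add: T_def)
  qed
  have "\<forall>\<^sub>F t in nhds 0. hyp3F2 (a / 14) (b / 14) (c / 14) (1 + e / 14) (1 + f / 14) (phi7 t) = R t"
  proof (rule hyp3F2_eq_if_pullback_ode[OF phi7_analytic R_an T_an T_an T_an phi7_0 deriv_phi7_0 R0 step0])
    show "\<forall>\<^sub>F t in at 0. phi7 t * deriv (T 1 1 Q1) t = deriv phi7 t * T 2 3 Q2 t"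
      using step[of 1 1 Q1] unfolding Q2 by (simp add: numeral_2_eq_2 numeral_3_eq_3)
    show "\<forall>\<^sub>F t in at 0. phi7 t * deriv (T 2 3 Q2) t = deriv phi7 t * T 3 5 Q3 t"
      using step[of 2 3 Q2] by (simp add: Q3)
    show "\<forall>\<^sub>F t in at 0. T 3 5 Q3 t + (1 + e / 14 + (1 + f / 14) - 2) * T 2 3 Q2 t
        + (1 + e / 14 - 1) * (1 + f / 14 - 1) * T 1 1 Q1 t
      = phi7 t * (T 3 5 Q3 t + (a / 14 + b / 14 + c / 14) * T 2 3 Q2 t
        + (a / 14 * (b / 14) + a / 14 * (c / 14) + b / 14 * (c / 14)) * T 1 1 Q1 t
        + a / 14 * (b / 14) * (c / 14) * R t)"
      using eventually_regular
    proof eventually_elim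
      case (elim t)
      define S where "S = ell_eval S7 t"
      define A where "A = ell_eval A7 t"
      define Z where "Z = ell_eval Z7 t"
      define F where "F = ell_eval c_F3t t"
      define q1 where "q1 = ell_eval Q1 t"
      define q2 where "q2 = ell_eval Q2 t"
      define q3 where "q3 = ell_eval Q3 t"
      have nz: "S \<noteq> 0" "A \<noteq> 0"
        using regular_imp_nonzero(4)[OF elim] A7_phi7(1)[OF elim] by (simp_all add: S_def A_def)
      have phi: "phi7 t = Z / A"
        using A7_phi7(2)[OF elim] nz(2) by (simp add: A_def Z_def field_simps)
      have AZ: "A - Z = 2 * (F * (S * S))"
        using arg_cong[OF A7_minus_Z7, of "\<lambda>p. ell_eval p t"]
        by (simp add: ell_eval_simps A_def Z_def F_def S_def)
      have ode': "2 * (F * q3) + ((e + f) * A - (a + b + c) * Z) * q2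
          + ((e * f) * A - (a * b + a * c + b * c) * Z) * q1 * (S * S) - (a * b * c) * Z * (S * (S * S)) = 0"
        using arg_cong[OF ode, of "\<lambda>p. ell_eval p t"] unfolding ell_eval_simps
        by (simp add: A_def Z_def F_def S_def q1_def q2_def q3_def ell_eval_def)
      \<comment> \<open>By \<open>AZ\<close> the difference of the two sides is \<open>S ^ 2\<close>
        times the left-hand side of \<open>ode'\<close>.\<close>
      have "A * (q3 + (e + f) * q2 * S ^ 2 + e * f * q1 * S ^ 4)
          = Z * (q3 + (a + b + c) * q2 * S ^ 2 + (a * b + a * c + b * c) * q1 * S ^ 4 + a * b * c * S ^ 5)"
        using AZ ode' by algebra
      then have "q3 + (e + f) * q2 * S ^ 2 + e * f * q1 * S ^ 4
          = Z / A * (q3 + (a + b + c) * q2 * S ^ 2 + (a * b + a * c + b * c) * q1 * S ^ 4 + a * b * c * S ^ 5)"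
        using nz(2) by (simp add: field_simps)
      then have "(q3 + (e + f) * q2 * S ^ 2 + e * f * q1 * S ^ 4) * R t / (14 ^ 3 * S ^ 5)
          = Z / A * ((q3 + (a + b + c) * q2 * S ^ 2 + (a * b + a * c + b * c) * q1 * S ^ 4 + a * b * c * S ^ 5)
            * R t / (14 ^ 3 * S ^ 5))"
        by simp
      moreover have "T 1 1 Q1 t = q1 * S ^ 4 * R t / (14 * S ^ 5)" "T 2 3 Q2 t = q2 * S ^ 2 * R t / (14 ^ 2 * S ^ 5)"
          "T 3 5 Q3 t = q3 * R t / (14 ^ 3 * S ^ 5)" "R t = S ^ 5 * R t / S ^ 5"
        using nz(1) by (simp_all add: T_def q1_def q2_def q3_def S_def[symmetric] field_simps power_numeral_even power_numeral_odd)
      ultimately show ?case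
        unfolding phi using nz by (simp add: add_divide_distrib ring_distribs mult_ac)
    qed
    have nonzero: "1 + x / 14 + of_nat n \<noteq> 0" if "14 + x = of_nat k" "k > 0" for x :: complex and k n
    proof -
      have "14 * (1 + x / 14 + of_nat n) = of_nat (k + 14 * n)"
        using that(1) by (simp add: algebra_simps)
      then show ?thesis
        using that(2) by (metis add_is_0 mult_zero_right neq0_conv of_nat_eq_0_iff)
    qed
    show "1 + e / 14 + of_nat n \<noteq> 0" "1 + f / 14 + of_nat n \<noteq> 0" for n
      by (intro nonzero[OF e] nonzero[OF f])+
  qed
  with R_an R0 R14 show ?thesis by blast
qed


section \<open>The hypergeometric equation on the curve\<close>

lemmas ell_arith_defs = ell_theta_def ell_mul_def ell_scale_def ell_deriv_def K7_def S7_def pderiv_pCons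

lemma ell_theta_Q11: "ell_theta Q11 1 Q11 = Q12"
  by (simp add: ell_arith_defs Q11_def Q12_def)

lemma ell_theta_Q12: "ell_theta Q11 3 Q12 = Q13"
  by (simp add: ell_arith_defs Q11_def Q12_def Q13_def)

lemma ell_theta_Q21: "ell_theta Q21 1 Q21 = Q22"
  by (simp add: ell_arith_defs Q21_def Q22_def)

lemma ell_theta_Q22: "ell_theta Q21 3 Q22 = Q23"
  by (simp add: ell_arith_defs Q21_def Q22_def Q23_def)

lemma ell_theta_Q31: "ell_theta Q31 1 Q31 = Q32"
  by (simp add: ell_arith_defs Q31_def Q32_def)

lemma ell_theta_Q32: "ell_theta Q31 3 Q32 = Q33"
  by (simp add: ell_arith_defs Q31_def Q32_def Q33_def)

lemmas ell_ode_defs = ell_mul_def ell_scale_def A7_def Z7_def S7_def c_F3t_def zero_prod_def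

text \<open>The differential equation multiplied by \<open>14 ^ 3 * A7 * S7 ^ 5 / R\<close> and
  divided by \<open>S7 ^ 2\<close>; the coefficient of the third derivative has become
  \<open>2 * c_F3t\<close>. The integers are 14 times the upper parameters and 14 times the lower
  ones minus 14.\<close>

lemma ell_ode_1:
  "ell_scale 2 (ell_mul c_F3t Q13)
    + ell_mul (ell_scale (- 6 + - 2) A7 - ell_scale (- 1 + 3 + 11) Z7) Q12
    + ell_mul (ell_mul (ell_scale (- 6 * - 2) A7 - ell_scale (- 1 * 3 + - 1 * 11 + 3 * 11) Z7) Q11) (ell_mul S7 S7)
    - ell_mul (ell_scale (- 1 * 3 * 11) Z7) (ell_mul S7 (ell_mul S7 S7)) = 0"
  by (simp add: ell_ode_defs Q11_def Q12_def Q13_def)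

lemma ell_ode_2:
  "ell_scale 2 (ell_mul c_F3t Q23)
    + ell_mul (ell_scale (- 4 + 2) A7 - ell_scale (1 + 5 + 13) Z7) Q22
    + ell_mul (ell_mul (ell_scale (- 4 * 2) A7 - ell_scale (1 * 5 + 1 * 13 + 5 * 13) Z7) Q21) (ell_mul S7 S7)
    - ell_mul (ell_scale (1 * 5 * 13) Z7) (ell_mul S7 (ell_mul S7 S7)) = 0"
  by (simp add: ell_ode_defs Q21_def Q22_def Q23_def)

lemma ell_ode_3:
  "ell_scale 2 (ell_mul c_F3t Q33)
    + ell_mul (ell_scale (4 + 6) A7 - ell_scale (5 + 9 + 17) Z7) Q32
    + ell_mul (ell_mul (ell_scale (4 * 6) A7 - ell_scale (5 * 9 + 5 * 17 + 9 * 17) Z7) Q31) (ell_mul S7 S7)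
    - ell_mul (ell_scale (5 * 9 * 17) Z7) (ell_mul S7 (ell_mul S7 S7)) = 0"
  by (simp add: ell_ode_defs Q31_def Q32_def Q33_def)

lemma hyp3F2_first:
  "\<exists>R. R analytic_on {0} \<and> R 0 = 1
    \<and> (\<forall>\<^sub>F t in nhds 0. R t ^ 14 = ell_eval c_1m4u t ^ 2 * ell_eval c_F3t t ^ 3 * ell_eval c_F4t t ^ 2
          / (ell_eval c_1m8u t * ell_eval c_G4 t ^ 7))
    \<and> (\<forall>\<^sub>F t in nhds 0. hyp3F2 (-1 / 14) (3 / 14) (11 / 14) (1 + - 6 / 14) (1 + - 2 / 14) (phi7 t) = R t)"
\<comment> \<open>Here 8 and 12 are 14 times the lower parameters 4/7 and 6/7.\<close>
proof (rule hyp3F2_phi7[OF _ _ _ ell_theta_Q11 ell_theta_Q12 ell_ode_1, of _ 8 12])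
  show "(\<lambda>t. ell_eval c_1m4u t ^ 2 * ell_eval c_F3t t ^ 3 * ell_eval c_F4t t ^ 2
          / (ell_eval c_1m8u t * ell_eval c_G4 t ^ 7)) analytic_on {0}"
    by (intro analytic_intros ell_eval_analytic) (auto simp: ell_eval_factors_0)
  show "has_logderiv (\<lambda>t. ell_eval c_1m4u t ^ 2 * ell_eval c_F3t t ^ 3 * ell_eval c_F4t t ^ 2
          / (ell_eval c_1m8u t * ell_eval c_G4 t ^ 7)) (kfac t * (2 * ell_eval Q11 t)) t" if "regular t" for t
  proof -
    have "ell_scale 2 Q11 = ell_scale 2 l_1m4u + ell_scale 3 l_F3t + ell_scale 2 l_F4t - l_1m8u - ell_scale 7 l_G4"
      by (simp add: ell_scale_def logderiv_coeff_defs)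
    then have *: "2 * ell_eval Q11 t = 2 * ell_eval l_1m4u t + 3 * ell_eval l_F3t t + 2 * ell_eval l_F4t t
        - ell_eval l_1m8u t - 7 * ell_eval l_G4 t"
      by (metis ell_eval_simps)
    have "kfac t * (2 * ell_eval Q11 t) = of_nat 2 * (kfac t * ell_eval l_1m4u t)
        + of_nat 3 * (kfac t * ell_eval l_F3t t) + of_nat 2 * (kfac t * ell_eval l_F4t t)
        - (kfac t * ell_eval l_1m8u t + of_nat 7 * (kfac t * ell_eval l_G4 t))"
      unfolding * by (simp add: algebra_simps)
    then show ?thesis
      by (simp only:) (intro has_logderiv_intros has_logderiv_factors that)
  qed
qed (simp_all add: ell_eval_factors_0)

lemma hyp3F2_second:
  "\<exists>R. R analytic_on {0} \<and> R 0 = 1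
    \<and> (\<forall>\<^sub>F t in nhds 0. R t ^ 14 = ell_eval c_1m4u t ^ 4 * ell_eval c_1m8u t ^ 2 * ell_eval c_F3 t
          * ell_eval c_F4t t ^ 4 * ell_eval c_G4 t ^ 7 / ell_eval c_G3 t ^ 14)
    \<and> (\<forall>\<^sub>F t in nhds 0. hyp3F2 (1 / 14) (5 / 14) (13 / 14) (1 + - 4 / 14) (1 + 2 / 14) (phi7 t) = R t)"
proof (rule hyp3F2_phi7[OF _ _ _ ell_theta_Q21 ell_theta_Q22 ell_ode_2, of _ 10 16])
  show "(\<lambda>t. ell_eval c_1m4u t ^ 4 * ell_eval c_1m8u t ^ 2 * ell_eval c_F3 t
          * ell_eval c_F4t t ^ 4 * ell_eval c_G4 t ^ 7 / ell_eval c_G3 t ^ 14) analytic_on {0}"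
    by (intro analytic_intros ell_eval_analytic) (auto simp: ell_eval_factors_0)
  show "has_logderiv (\<lambda>t. ell_eval c_1m4u t ^ 4 * ell_eval c_1m8u t ^ 2 * ell_eval c_F3 t
          * ell_eval c_F4t t ^ 4 * ell_eval c_G4 t ^ 7 / ell_eval c_G3 t ^ 14)
          (kfac t * (2 * ell_eval Q21 t)) t" if "regular t" for t
  proof -
    have "ell_scale 2 Q21 = ell_scale 4 l_1m4u + ell_scale 2 l_1m8u + l_F3 + ell_scale 4 l_F4t
        + ell_scale 7 l_G4 - ell_scale 14 l_G3"
      by (simp add: ell_scale_def logderiv_coeff_defs)
    then have *: "2 * ell_eval Q21 t = 4 * ell_eval l_1m4u t + 2 * ell_eval l_1m8u t + ell_eval l_F3 t
        + 4 * ell_eval l_F4t t + 7 * ell_eval l_G4 t - 14 * ell_eval l_G3 t"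
      by (metis ell_eval_simps)
    have "kfac t * (2 * ell_eval Q21 t) = of_nat 4 * (kfac t * ell_eval l_1m4u t)
        + of_nat 2 * (kfac t * ell_eval l_1m8u t) + kfac t * ell_eval l_F3 t
        + of_nat 4 * (kfac t * ell_eval l_F4t t) + of_nat 7 * (kfac t * ell_eval l_G4 t)
        - of_nat 14 * (kfac t * ell_eval l_G3 t)"
      unfolding * by (simp add: algebra_simps)
    then show ?thesis
      by (simp only:) (intro has_logderiv_intros has_logderiv_factors that)
  qed
qed (simp_all add: ell_eval_factors_0)

text \<open>In the third right-hand side the zeros and poles of the factors at \<open>t = 0\<close> cancel.
  This formula is its holomorphic extension.\<close>

definition third_rhs :: "complex \<Rightarrow> complex" where
  "third_rhs t = ell_eval c_1m8u t ^ 14 * (E7s t - t) ^ 3 * (E7s t - 5 * t - 8 * t ^ 2 * E7s t + 24 * t ^ 3) ^ 35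
     / ((E7s t + t) ^ 6 * ell_eval c_F3t t * ell_eval c_G3 t ^ 42)"

lemma third_rhs_eq:
  assumes "t \<noteq> 0"
  shows "third_rhs t = ell_eval c_1m8u t ^ 14 * ell_eval c_vmu t ^ 3 * ell_eval c_G4h t ^ 35
     / (ell_eval c_u t ^ 16 * ell_eval c_vpu t ^ 6 * ell_eval c_F3t t * ell_eval c_G3 t ^ 42)"
proof -
  define w where "w = E7s t - 5 * t - 8 * t ^ 2 * E7s t + 24 * t ^ 3"
  have factors: "ell_eval c_vmu t = t * (E7s t - t)" "ell_eval c_vpu t = t * (E7s t + t)"
      "ell_eval c_u t = t ^ 2" "ell_eval c_G4h t = t * w"
    by (simp_all add: ell_eval_def factor_defs w_def algebra_simps power2_eq_square power3_eq_cube)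
  have "ell_eval c_1m8u t ^ 14 * ell_eval c_vmu t ^ 3 * ell_eval c_G4h t ^ 35
      / (ell_eval c_u t ^ 16 * ell_eval c_vpu t ^ 6 * ell_eval c_F3t t * ell_eval c_G3 t ^ 42)
    = t ^ 38 * (ell_eval c_1m8u t ^ 14 * (E7s t - t) ^ 3 * w ^ 35)
      / (t ^ 38 * ((E7s t + t) ^ 6 * ell_eval c_F3t t * ell_eval c_G3 t ^ 42))"
  proof -
    \<comment> \<open>The orders at \<open>t = 0\<close> agree: \<open>3 + 35\<close> in the
      numerator and \<open>2 * 16 + 6\<close> in the denominator.\<close>
    have num: "t ^ 38 = t ^ 3 * t ^ 35" and den: "t ^ 38 = (t ^ 2) ^ 16 * t ^ 6"
      by (simp_all flip: power_mult power_add)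
    have "x * (t * y) ^ 3 * (t * z) ^ 35 = t ^ 38 * (x * y ^ 3 * z ^ 35)" for x y z
      by (simp only: num power_mult_distrib mult_ac)
    moreover have "(t ^ 2) ^ 16 * (t * y) ^ 6 * x * z = t ^ 38 * (y ^ 6 * x * z)" for x y z
      by (simp only: den power_mult_distrib mult_ac)
    ultimately show ?thesis
      unfolding factors by (simp only:)
  qed
  then show ?thesis
    using assms by (simp add: third_rhs_def w_def)
qed

lemma hyp3F2_third:
  "\<exists>R. R analytic_on {0} \<and> R 0 = 1 \<and> (\<forall>\<^sub>F t in nhds 0. R t ^ 14 = third_rhs t)
    \<and> (\<forall>\<^sub>F t in nhds 0. hyp3F2 (5 / 14) (9 / 14) (17 / 14) (1 + 4 / 14) (1 + 6 / 14) (phi7 t) = R t)"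
proof (rule hyp3F2_phi7[OF _ _ _ ell_theta_Q31 ell_theta_Q32 ell_ode_3, of _ 18 20])
  show "third_rhs analytic_on {0}"
    unfolding third_rhs_def
    by (intro analytic_intros ell_eval_analytic E7s_analytic) (auto simp: ell_eval_factors_0 E7s_0)
  show "has_logderiv third_rhs (kfac t * (2 * ell_eval Q31 t)) t" if t: "regular t" for t
  proof (rule has_logderiv_cong_ev)
    \<comment> \<open>A regular point has a neighbourhood avoiding 0, on which the extension agrees
      with the product of factors.\<close>
    have "\<forall>\<^sub>F x in nhds t. x \<noteq> 0"
      using t by (intro t1_space_nhds) (simp add: regular_def)
    then show "\<forall>\<^sub>F t in nhds t. ell_eval c_1m8u t ^ 14 * ell_eval c_vmu t ^ 3 * ell_eval c_G4h t ^ 35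
        / (ell_eval c_u t ^ 16 * ell_eval c_vpu t ^ 6 * ell_eval c_F3t t * ell_eval c_G3 t ^ 42) = third_rhs t"
      by eventually_elim (simp add: third_rhs_eq)
    have "ell_scale 2 Q31 = ell_scale 14 l_1m8u + ell_scale 3 l_vmu + ell_scale 35 l_G4h - ell_scale 16 l_u
        - ell_scale 6 l_vpu - l_F3t - ell_scale 42 l_G3"
      by (simp add: ell_scale_def logderiv_coeff_defs)
    then have *: "2 * ell_eval Q31 t = 14 * ell_eval l_1m8u t + 3 * ell_eval l_vmu t + 35 * ell_eval l_G4h t
        - 16 * ell_eval l_u t - 6 * ell_eval l_vpu t - ell_eval l_F3t t - 42 * ell_eval l_G3 t"
      by (metis ell_eval_simps)
    have "kfac t * (2 * ell_eval Q31 t) = of_nat 14 * (kfac t * ell_eval l_1m8u t)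
        + of_nat 3 * (kfac t * ell_eval l_vmu t) + of_nat 35 * (kfac t * ell_eval l_G4h t)
        - (of_nat 16 * (kfac t * ell_eval l_u t) + of_nat 6 * (kfac t * ell_eval l_vpu t)
          + kfac t * ell_eval l_F3t t + of_nat 42 * (kfac t * ell_eval l_G3 t))"
      unfolding * by (simp add: algebra_simps)
    then show "has_logderiv (\<lambda>t. ell_eval c_1m8u t ^ 14 * ell_eval c_vmu t ^ 3 * ell_eval c_G4h t ^ 35
        / (ell_eval c_u t ^ 16 * ell_eval c_vpu t ^ 6 * ell_eval c_F3t t * ell_eval c_G3 t ^ 42))
        (kfac t * (2 * ell_eval Q31 t)) t"
      by (simp only:) (intro has_logderiv_intros has_logderiv_factors t)
  qed
qed (simp_all add: third_rhs_def ell_eval_factors_0 E7s_0)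

text \<open>Fourteenth powers together with \<open>R 0 = 1\<close> and holomorphy encode the choice
  of branch. They are compared off \<open>t = 0\<close> because the third quotient is 0/0
  there.\<close>

theorem mainTheorem14:
  shows "\<exists>r>0.
   (\<exists>R. R holomorphic_on ball 0 r \<and> R 0 = 1 \<and>
      (\<forall>t\<in>ball 0 r - {0}. let u = E7u t; v = E7v t in
          R t ^ 14 = (1 - 4*u)^2 * F3t u v ^ 3 * F4t u v ^ 2 / ((1 - 8*u) * G4 u v ^ 7)) \<and>
      (\<forall>t\<in>ball 0 r. hyp3F2 (-1/14) (3/14) (11/14) (4/7) (6/7) (Phi7 (E7u t) (E7v t)) = R t))
 \<and> (\<exists>R. R holomorphic_on ball 0 r \<and> R 0 = 1 \<and>
      (\<forall>t\<in>ball 0 r - {0}. let u = E7u t; v = E7v t in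
          R t ^ 14 = (1 - 4*u)^4 * (1 - 8*u)^2 * F3 u v * F4t u v ^ 4 * G4 u v ^ 7 / G3 u v ^ 14) \<and>
      (\<forall>t\<in>ball 0 r. hyp3F2 (1/14) (5/14) (13/14) (5/7) (8/7) (Phi7 (E7u t) (E7v t)) = R t))
 \<and> (\<exists>R. R holomorphic_on ball 0 r \<and> R 0 = 1 \<and>
      (\<forall>t\<in>ball 0 r - {0}. let u = E7u t; v = E7v t in
          R t ^ 14 = (1 - 8*u)^14 * (v - u)^3 * G4h u v ^ 35
                     / (u ^ 16 * (v + u)^6 * F3t u v * G3 u v ^ 42)) \<and>
      (\<forall>t\<in>ball 0 r. hyp3F2 (5/14) (9/14) (17/14) (9/7) (10/7) (Phi7 (E7u t) (E7v t)) = R t))"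
proof -
  obtain R1 where R1: "R1 analytic_on {0}" "R1 0 = 1"
    "\<forall>\<^sub>F t in nhds 0. R1 t ^ 14 = ell_eval c_1m4u t ^ 2 * ell_eval c_F3t t ^ 3 * ell_eval c_F4t t ^ 2
          / (ell_eval c_1m8u t * ell_eval c_G4 t ^ 7)"
    "\<forall>\<^sub>F t in nhds 0. hyp3F2 (-1 / 14) (3 / 14) (11 / 14) (1 + - 6 / 14) (1 + - 2 / 14) (phi7 t) = R1 t"
    using hyp3F2_first by blast
  obtain R2 where R2: "R2 analytic_on {0}" "R2 0 = 1"
    "\<forall>\<^sub>F t in nhds 0. R2 t ^ 14 = ell_eval c_1m4u t ^ 4 * ell_eval c_1m8u t ^ 2 * ell_eval c_F3 t
          * ell_eval c_F4t t ^ 4 * ell_eval c_G4 t ^ 7 / ell_eval c_G3 t ^ 14"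
    "\<forall>\<^sub>F t in nhds 0. hyp3F2 (1 / 14) (5 / 14) (13 / 14) (1 + - 4 / 14) (1 + 2 / 14) (phi7 t) = R2 t"
    using hyp3F2_second by blast
  obtain R3 where R3: "R3 analytic_on {0}" "R3 0 = 1" "\<forall>\<^sub>F t in nhds 0. R3 t ^ 14 = third_rhs t"
    "\<forall>\<^sub>F t in nhds 0. hyp3F2 (5 / 14) (9 / 14) (17 / 14) (1 + 4 / 14) (1 + 6 / 14) (phi7 t) = R3 t"
    using hyp3F2_third by blast
  have params: "(1 + - 6 / 14 :: complex) = 4 / 7" "(1 + - 2 / 14 :: complex) = 6 / 7"
    "(1 + - 4 / 14 :: complex) = 5 / 7" "(1 + 2 / 14 :: complex) = 8 / 7"
    "(1 + 4 / 14 :: complex) = 9 / 7" "(1 + 6 / 14 :: complex) = 10 / 7"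
    by simp_all
  obtain r where r: "r > 0" and ball: "\<And>t. t \<in> ball 0 r \<Longrightarrow>
      (R1 t ^ 14 = ell_eval c_1m4u t ^ 2 * ell_eval c_F3t t ^ 3 * ell_eval c_F4t t ^ 2
          / (ell_eval c_1m8u t * ell_eval c_G4 t ^ 7)
      \<and> hyp3F2 (-1 / 14) (3 / 14) (11 / 14) (4 / 7) (6 / 7) (phi7 t) = R1 t)
      \<and> (R2 t ^ 14 = ell_eval c_1m4u t ^ 4 * ell_eval c_1m8u t ^ 2 * ell_eval c_F3 t
          * ell_eval c_F4t t ^ 4 * ell_eval c_G4 t ^ 7 / ell_eval c_G3 t ^ 14
      \<and> hyp3F2 (1 / 14) (5 / 14) (13 / 14) (5 / 7) (8 / 7) (phi7 t) = R2 t)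
      \<and> (R3 t ^ 14 = third_rhs t
      \<and> hyp3F2 (5 / 14) (9 / 14) (17 / 14) (9 / 7) (10 / 7) (phi7 t) = R3 t)
      \<and> R1 analytic_on {t} \<and> R2 analytic_on {t} \<and> R3 analytic_on {t}"
  proof -
    note evs = eventually_conj[OF eventually_conj[OF R1(3,4)] eventually_conj[OF eventually_conj[OF R2(3,4)]
      eventually_conj[OF eventually_conj[OF R3(3,4)] eventually_conj[OF R1(1)[THEN eventually_analytic_at]
      eventually_conj[OF R2(1)[THEN eventually_analytic_at] R3(1)[THEN eventually_analytic_at]]]]], unfolded params]
    show ?thesis
      using evs unfolding eventually_nhds_metric
      by (elim exE conjE, intro that) (auto simp only: mem_ball dist_commute)
  qed
  have hol: "R1 holomorphic_on ball 0 r" "R2 holomorphic_on ball 0 r" "R3 holomorphic_on ball 0 r"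
    using ball by (meson analytic_imp_holomorphic analytic_on_analytic_at)+
  show ?thesis
    unfolding Let_def
  proof (intro exI[of _ r] conjI r)
    show "\<exists>R. R holomorphic_on ball 0 r \<and> R 0 = 1 \<and>
      (\<forall>t\<in>ball 0 r - {0}. R t ^ 14 = (1 - 4 * E7u t)^2 * F3t (E7u t) (E7v t) ^ 3 * F4t (E7u t) (E7v t) ^ 2
        / ((1 - 8 * E7u t) * G4 (E7u t) (E7v t) ^ 7)) \<and>
      (\<forall>t\<in>ball 0 r. hyp3F2 (-1/14) (3/14) (11/14) (4/7) (6/7) (phi7 t) = R t)"
      using ball hol R1(2)
      by (intro exI[of _ R1]) (simp add: ell_eval_1m4u ell_eval_F3t ell_eval_F4t ell_eval_1m8u ell_eval_G4)
    show "\<exists>R. R holomorphic_on ball 0 r \<and> R 0 = 1 \<and>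
      (\<forall>t\<in>ball 0 r - {0}. R t ^ 14 = (1 - 4 * E7u t)^4 * (1 - 8 * E7u t)^2 * F3 (E7u t) (E7v t)
        * F4t (E7u t) (E7v t) ^ 4 * G4 (E7u t) (E7v t) ^ 7 / G3 (E7u t) (E7v t) ^ 14) \<and>
      (\<forall>t\<in>ball 0 r. hyp3F2 (1/14) (5/14) (13/14) (5/7) (8/7) (phi7 t) = R t)"
      using ball hol R2(2)
      by (intro exI[of _ R2]) (simp add: ell_eval_1m4u ell_eval_F3 ell_eval_F4t ell_eval_1m8u ell_eval_G3 ell_eval_G4)
    show "\<exists>R. R holomorphic_on ball 0 r \<and> R 0 = 1 \<and>
      (\<forall>t\<in>ball 0 r - {0}. R t ^ 14 = (1 - 8 * E7u t)^14 * (E7v t - E7u t)^3 * G4h (E7u t) (E7v t) ^ 35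
        / (E7u t ^ 16 * (E7v t + E7u t)^6 * F3t (E7u t) (E7v t) * G3 (E7u t) (E7v t) ^ 42)) \<and>
      (\<forall>t\<in>ball 0 r. hyp3F2 (5/14) (9/14) (17/14) (9/7) (10/7) (phi7 t) = R t)"
      using ball hol R3(2)
      by (intro exI[of _ R3]) (simp add: third_rhs_eq ell_eval_u ell_eval_vmu ell_eval_vpu ell_eval_F3t
        ell_eval_1m8u ell_eval_G3 ell_eval_G4h)
  qed
qed

end
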